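(* Let $B$ and $R$ be two finite sets of points in the plane (the real affine plane or the real projective plane) such that $B\cup R$ is non-collinear. Then there exists a line $\ell$ such that $|\ell\cap B\cap R|\leq 2\leq|\ell\cap(B\cup R)|$, and $\ell\cap(B\cup R)$ is contained in either $B$ or $R$.
   Context: A set of points is non-collinear if no line contains all of its points. The sets $B$ and $R$ need not be disjoint. *)

theory Defs
  imports "HOL-Analysis.Analysis"
begin

text \<open>A plane is given by its set of lines, a line being the set of the points on it.\<close>

definition noncollinear :: "'p set set \<Rightarrow> 'p set \<Rightarrow> bool" where
  "noncollinear lines S \<longleftrightarrow> \<not> (\<exists>l\<in>lines. S \<subseteq> l)"

definition affine_lines :: "(real^2) set set" where
  "affine_lines = {l. affine l \<and> aff_dim l = 1}"

text \<open>The real projective plane: its points are the one-dimensional subspaces of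
  three-dimensional space, and the points on a line are those contained in a
  fixed two-dimensional subspace.\<close>

definition proj_points :: "(real^3) set set" where
  "proj_points = {p. subspace p \<and> dim p = 1}"

definition proj_lines :: "(real^3) set set set" where
  "proj_lines = {{p \<in> proj_points. p \<subseteq> W} | W. subspace W \<and> dim W = 2}"

lemma noncollinear_affine_lines_iff: "noncollinear affine_lines S \<longleftrightarrow> \<not> collinear S"
proof -
  have "collinear S" if "affine l" "aff_dim l = 1" "S \<subseteq> l" for l
    using that aff_dim_subset[of S l] by (simp add: collinear_aff_dim)
  moreover have "\<exists>l. affine l \<and> aff_dim l = 1 \<and> S \<subseteq> l" if "collinear S"
  proof -
    obtain u v where uv: "S \<subseteq> affine hull {u, v}"
      using \<open>collinear S\<close> by (auto simp: collinear_affine_hull)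
    obtain w where w: "w \<noteq> u" "S \<subseteq> affine hull {u, w}"
    proof (cases "u = v")
      case True
      have "S \<subseteq> affine hull {u, u + axis 1 1}"
        using uv True hull_inc[of u "{u, u + axis 1 1}"] by auto
      then show ?thesis
        by (rule that[rotated]) (simp add: axis_eq_0_iff)
    next
      case False
      then show ?thesis
        using uv by (intro that[of v]) auto
    qed
    have "aff_dim {u, w} = 1"
      using w(1) by (auto simp: aff_dim_2)
    then show ?thesis
      using w(2) by (intro exI[of _ "affine hull {u, w}"]) auto
  qed
  ultimately show ?thesis
    by (auto simp: noncollinear_def affine_lines_def)
qed

end

theory Submission
  imports Defs
begin

text \<open>Let $S = B \cup R$, and call a line through two points of $S$ bad if it meets $B \cap R$ in
  more than two points, or if it contains both a point of $S$ outside $B$ and one outside $R$.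
  Some line has to be found that is not bad. The proof assigns weights to pairs of points and
  double counts.

  Give shade 0 to the points of $B - R$, shade 1 to those of $R - B$, and shade $1/2$ to those of
  $B \cap R$. A pair of points weighs the difference of the shades, except that two points of
  $B \cap R$ weigh $2/3$. Then every weight lies between 0 and 1, and the three
  pairs of a triple weigh at most 2 together. Arrange the points of $S$ on a line in cyclic
  order, the last point being a neighbour of the first. On a bad line the weights of the neighbouring
  pairs add up to at least 2 (\<open>pair_weight_line_bound\<close>): either the shade runs from
  0 to 1 and back, or there are at least three points of $B \cap R$, and every pair
  weighs at least $1/3$ for each of its ends in $B \cap R$.

  On the other hand, the average of these cyclic sums over all lines is less than 2
  (\<open>pair_sum_less\<close>). This comes from Euler's relation for the line arrangement dual to $S$,
  in a local form that needs no faces. What replaces a face is a subset $A$ of $S$ that a line separates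
  from $S - A$. Rotate a separating line within the freedom that it has. At either end of the rotation
  it is an inner common tangent of $A$ and $S - A$, which touches the two sides in neighbouring points
  $p \in A$ and $q \notin A$. In between, the point of $A$ closest to
  the line can only change across an edge of the convex hull of $A$, the closest point of $S - A$
  only across an edge of the hull of $S - A$, and the ends of such an edge are the first and
  the last point of $S$ on their line. Let $A$ have $s$ facing edges of these two kinds. If the two
  tangents exist, then $s \geq 1$, because they are distinct unless $S$ is collinear. If $s = 1$, the two
  tangent pairs and the edge are the three pairs of a triple and weigh at most 2; if $s \geq 2$, these
  $s + 2$ pairs weigh at most $s + 2 \leq 2 s$. So the pairs belonging to $A$ never weigh more than $2 s$
  (\<open>cell_bound\<close>), and they weigh less than that for $A = S$, which has facing
  edges but no tangents. In the sum over all $A$ each neighbouring pair and each pair of a first and a last point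
  is counted four times: for the pairs of the first kind, there are two sides and two directions of
  rotation to choose from. The facing edges number four for each line, which gives the bound.

  In the projective plane some line misses the finite set $S$; removing it leaves an affine plane that
  contains $S$.\<close>

section \<open>Oriented area and the order of directions\<close>

text \<open>Only the sign of $\sigma$ matters. Changing it reflects the plane, so that a lemma about
  counterclockwise rotation also yields the one about clockwise rotation.\<close>
definition wedge :: "real \<Rightarrow> real^2 \<Rightarrow> real^2 \<Rightarrow> real" where
  "wedge \<sigma> u v = \<sigma> * (u $ 1 * v $ 2 - u $ 2 * v $ 1)"

lemma wedge_simps:
  "wedge \<sigma> u (v - w) = wedge \<sigma> u v - wedge \<sigma> u w"
  "wedge \<sigma> (v - w) u = wedge \<sigma> v u - wedge \<sigma> w u"
  "wedge \<sigma> u (k *\<^sub>R v) = k * wedge \<sigma> u v"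
  "wedge \<sigma> (k *\<^sub>R u) v = k * wedge \<sigma> u v"
  "wedge (- \<sigma>) u v = - wedge \<sigma> u v"
  "wedge \<sigma> u u = 0"
  by (simp_all add: wedge_def algebra_simps)

lemma wedge_swap: "wedge \<sigma> v u = - wedge \<sigma> u v"
  by (simp add: wedge_def algebra_simps)

lemma wedge_plucker:
  "wedge \<sigma> d v * wedge \<sigma> w z + wedge \<sigma> d z * wedge \<sigma> v w = wedge \<sigma> d w * wedge \<sigma> v z"
  by (simp add: wedge_def algebra_simps)

lemma wedge_eq_0D:
  assumes "\<sigma> \<noteq> 0" "u \<noteq> 0" "wedge \<sigma> u v = 0"
  obtains k where "v = k *\<^sub>R u"
proof -
  have eq: "u $ 1 * v $ 2 = u $ 2 * v $ 1"
    using assms by (simp add: wedge_def)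
  consider "u $ 1 \<noteq> 0" | "u $ 2 \<noteq> 0"
    using assms(2) by (auto simp: vec_eq_iff forall_2)
  then show thesis
  proof cases
    case 1
    then have "v = (v $ 1 / u $ 1) *\<^sub>R u"
      using eq by (simp add: vec_eq_iff forall_2 field_simps)
    then show thesis by (rule that)
  next
    case 2
    then have "v = (v $ 2 / u $ 2) *\<^sub>R u"
      using eq by (simp add: vec_eq_iff forall_2 field_simps)
    then show thesis by (rule that)
  qed
qed

text \<open>For vectors in a half plane that is closed at one end and open at the other, this compares angles.
  The set $K$ decides between parallel vectors, by admitting all positive multiples, only those at least
  as long, or only those at most as long.\<close>
definition precedes :: "real \<Rightarrow> real set \<Rightarrow> real^2 \<Rightarrow> real^2 \<Rightarrow> bool" where
  "precedes \<sigma> K v w \<longleftrightarrow> 0 < wedge \<sigma> v w \<or> (\<exists>k\<in>K. w = k *\<^sub>R v)"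

lemma precedes_mono: "precedes \<sigma> K v w \<Longrightarrow> K \<subseteq> K' \<Longrightarrow> precedes \<sigma> K' v w"
  by (auto simp: precedes_def)

lemma precedes_wedge_nonneg: "precedes \<sigma> K v w \<Longrightarrow> 0 \<le> wedge \<sigma> v w"
  by (auto simp: precedes_def wedge_simps)

text \<open>Comparison of angles is transitive within the half plane that starts in direction $d$. In the
  generic case the Pluecker relation writes a positive multiple of \<open>wedge \<sigma> v z\<close> as a positive
  combination of the other two.\<close>
lemma wedge_trans:
  assumes v: "precedes \<sigma> {0<..} d v" and w: "precedes \<sigma> {0<..} d w"
    and z: "precedes \<sigma> {0<..} d z"
    and vw: "0 \<le> wedge \<sigma> v w" and wz: "0 \<le> wedge \<sigma> w z"
    and strict: "0 < wedge \<sigma> v w \<or> 0 < wedge \<sigma> w z"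
  shows "0 < wedge \<sigma> v z"
proof -
  have nonneg: "0 \<le> wedge \<sigma> d v" "0 \<le> wedge \<sigma> d w" "0 \<le> wedge \<sigma> d z"
    using v w z by (auto dest: precedes_wedge_nonneg)
  have parallel: "\<exists>k>0. a = k *\<^sub>R d" if "precedes \<sigma> {0<..} d a" "wedge \<sigma> d a = 0" for a
    using that by (auto simp: precedes_def)
  consider "wedge \<sigma> d w = 0" | "0 < wedge \<sigma> d w" "wedge \<sigma> d z = 0"
    | "0 < wedge \<sigma> d w" "0 < wedge \<sigma> d z" "wedge \<sigma> d v = 0"
    | "0 < wedge \<sigma> d w" "0 < wedge \<sigma> d z" "0 < wedge \<sigma> d v"
    using nonneg by linarith
  then show ?thesis
  proof cases
    case 1
    then obtain k where k: "k > 0" "w = k *\<^sub>R d"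
      using parallel[OF w] by blast
    have "wedge \<sigma> v w = - (k * wedge \<sigma> d v)"
      using wedge_swap[of \<sigma> v d] by (simp add: k wedge_simps)
    then have "wedge \<sigma> d v = 0"
      using vw k nonneg(1) by (smt (verit) mult_pos_pos)
    then obtain k' where k': "k' > 0" "v = k' *\<^sub>R d"
      using parallel[OF v] by blast
    show ?thesis
      using k k' strict by (simp add: wedge_simps zero_less_mult_iff)
  next
    case 2
    then obtain k where k: "k > 0" "z = k *\<^sub>R d"
      using parallel[OF z] by blast
    have "wedge \<sigma> w z = - (k * wedge \<sigma> d w)"
      using wedge_swap[of \<sigma> w d] by (simp add: k wedge_simps)
    then show ?thesis
      using wz k 2(1) by (smt (verit) mult_pos_pos)
  next
    case 3
    then obtain k where "k > 0" "v = k *\<^sub>R d"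
      using parallel[OF v] by blast
    then show ?thesis
      using 3(2) by (simp add: wedge_simps)
  next
    case 4
    have "0 < wedge \<sigma> d w * wedge \<sigma> v z"
      unfolding wedge_plucker[of \<sigma> d v w z, symmetric] using strict 4 vw wz
      by (auto intro: add_pos_nonneg add_nonneg_pos)
    then show ?thesis
      using 4(1) by (simp add: zero_less_mult_iff)
  qed
qed

lemma half_plane_nonzero:
  assumes "d \<noteq> 0" "precedes \<sigma> {0<..} d v"
  shows "v \<noteq> 0"
  using assms by (auto simp: precedes_def wedge_def)

text \<open>The half plane contains at most one of two opposite directions.\<close>
lemma half_plane_parallel:
  assumes "\<sigma> \<noteq> 0" "d \<noteq> 0" "precedes \<sigma> {0<..} d v" "precedes \<sigma> {0<..} d w" "wedge \<sigma> v w = 0"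
  obtains k where "k > 0" "w = k *\<^sub>R v"
proof -
  have "v \<noteq> 0" "w \<noteq> 0"
    using half_plane_nonzero assms by blast+
  then obtain k where k: "w = k *\<^sub>R v"
    using wedge_eq_0D assms by metis
  have "k > 0"
  proof (cases "wedge \<sigma> d v > 0")
    case True
    have "0 \<le> k * wedge \<sigma> d v"
      using precedes_wedge_nonneg[OF assms(4)] by (simp add: k wedge_simps)
    then show ?thesis
      using True \<open>w \<noteq> 0\<close> k by (auto simp: zero_le_mult_iff)
  next
    case False
    then obtain a where a: "a > 0" "v = a *\<^sub>R d"
      using assms(3) by (auto simp: precedes_def)
    then obtain b where b: "b > 0" "w = b *\<^sub>R d"
      using assms(4) by (auto simp: precedes_def k wedge_simps)
    have "(k * a) *\<^sub>R d = b *\<^sub>R d"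
      using k a(2) b(2) by (metis scaleR_scaleR)
    then have "k * a = b"
      using assms(2) by simp
    then show ?thesis
      using a(1) b(1) zero_less_mult_pos2 by blast
  qed
  then show thesis
    using k that by blast
qed

text \<open>The conditions on $K$ make \<open>precedes (- \<sigma>) K\<close> a total preorder on the half plane, so that a finite set
  has a vector of largest angle, and among these the longest or shortest as prescribed by $K$.\<close>
lemma last_direction:
  assumes "\<sigma> \<noteq> 0" "d \<noteq> 0" "finite D" "D \<noteq> {}" "\<And>v. v \<in> D \<Longrightarrow> precedes \<sigma> {0<..} d v"
    and K: "\<And>k. k \<in> K \<Longrightarrow> 0 < k" "1 \<in> K" "\<And>a b. a \<in> K \<Longrightarrow> b \<in> K \<Longrightarrow> a * b \<in> K"
      "\<And>k. 0 < k \<Longrightarrow> k \<in> K \<or> inverse k \<in> K"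
  obtains v where "v \<in> D" "\<And>w. w \<in> D \<Longrightarrow> precedes (- \<sigma>) K v w"
proof -
  have "\<exists>v\<in>D. \<forall>w\<in>D. precedes (- \<sigma>) K v w"
    using assms(3-5)
  proof (induction D rule: finite_ne_induct)
    case (singleton x)
    then show ?case using K(2) by (auto simp: precedes_def intro!: bexI[of _ 1])
  next
    case (insert u D)
    then obtain v where v: "v \<in> D" "\<forall>w\<in>D. precedes (- \<sigma>) K v w" by auto
    have hu: "precedes \<sigma> {0<..} d u" and hv: "precedes \<sigma> {0<..} d v"
      using insert.prems v(1) by auto
    have refl: "precedes (- \<sigma>) K u u"
      using K(2) by (auto simp: precedes_def intro!: bexI[of _ 1])
    consider "0 < wedge \<sigma> u v" | "0 < wedge \<sigma> v u" | "wedge \<sigma> v u = 0"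
      using wedge_swap[of \<sigma> u v] by linarith
    then show ?case
    proof cases
      case 1
      then have "precedes (- \<sigma>) K v u"
        using wedge_swap[of \<sigma> u v] by (simp add: precedes_def wedge_simps)
      then show ?thesis using v by auto
    next
      case 2
      have "precedes (- \<sigma>) K u w" if "w \<in> D" for w
      proof -
        have "0 \<le> wedge \<sigma> w v"
          using precedes_wedge_nonneg[of "-\<sigma>" K v w] v(2) that wedge_swap[of \<sigma> v w]
          by (simp add: wedge_simps)
        then have "0 < wedge \<sigma> w u"
          using wedge_trans[OF _ hv hu, of w] insert.prems that 2 by auto
        then show ?thesis
          using wedge_swap[of \<sigma> w u] by (simp add: precedes_def wedge_simps)
      qed
      then show ?thesis using refl by auto
    next
      case 3
      then obtain k where k: "k > 0" "u = k *\<^sub>R v"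
        using half_plane_parallel[OF assms(1,2) hv hu] by blast
      show ?thesis
      proof (cases "k \<in> K")
        case True
        then have "precedes (- \<sigma>) K v u"
          using k by (auto simp: precedes_def)
        then show ?thesis using v by auto
      next
        case False
        then have inv: "inverse k \<in> K" using K(4) k by blast
        have vk: "v = inverse k *\<^sub>R u" using k by simp
        have "precedes (- \<sigma>) K u w" if "w \<in> D" for w
        proof -
          have "0 < wedge (- \<sigma>) v w \<or> (\<exists>l\<in>K. w = l *\<^sub>R v)"
            using v(2) that by (simp add: precedes_def)
          then show ?thesis
          proof
            assume "0 < wedge (- \<sigma>) v w"
            then have "0 < wedge (- \<sigma>) u w"
              using k by (simp add: wedge_simps zero_less_mult_iff mult_less_0_iff)
            then show ?thesis by (simp add: precedes_def)
          next
            assume "\<exists>l\<in>K. w = l *\<^sub>R v"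
            then obtain l where l: "l \<in> K" "w = l *\<^sub>R v" by blast
            then have "w = (l * inverse k) *\<^sub>R u" using vk by simp
            then show ?thesis
              using K(3)[OF l(1) inv] by (auto simp: precedes_def)
          qed
        qed
        then show ?thesis using refl by auto
      qed
    qed
  qed
  then show thesis using that by blast
qed

section \<open>Inner tangents and facing edges\<close>

text \<open>The line through $p$ and $q$ is an inner common tangent of $A$ and $S - A$, and $p$, $q$ are the points of
  the two sides that are next to each other on it. In terms of differences this says that
  $p - q$ has the first direction among all $x - y$ with $x \in A$ and $y \in S - A$, and is the shortest of
  these differences. The other inner tangent has the last direction: it is the one for $-\sigma$.\<close>
definition tangent :: "real \<Rightarrow> (real^2) set \<Rightarrow> (real^2) set \<Rightarrow> real^2 \<Rightarrow> real^2 \<Rightarrow> bool" where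
  "tangent \<sigma> S A p q \<longleftrightarrow> A \<subseteq> S \<and> p \<in> A \<and> q \<in> S - A \<and>
     (\<forall>x\<in>A. \<forall>y\<in>S - A. precedes \<sigma> {1..} (p - q) (x - y))"

text \<open>The segment from $e$ to $f$ is an edge of the convex hull of $A$, and $S - A$ lies strictly on the
  other side of its line.\<close>
definition facing :: "real \<Rightarrow> (real^2) set \<Rightarrow> (real^2) set \<Rightarrow> real^2 \<Rightarrow> real^2 \<Rightarrow> bool" where
  "facing \<sigma> S A e f \<longleftrightarrow> A \<subseteq> S \<and> e \<in> A \<and> f \<in> A \<and> e \<noteq> f \<and>
     (\<forall>x\<in>A. precedes \<sigma> {0..1} (f - e) (x - e)) \<and>
     (\<forall>y\<in>S - A. wedge \<sigma> (f - e) (y - e) < 0)"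

lemma tangent_complement: "tangent \<sigma> S A p q \<Longrightarrow> tangent \<sigma> S (S - A) q p"
proof -
  assume t: "tangent \<sigma> S A p q"
  have "precedes \<sigma> {1..} (q - p) (y - x)" if "x \<in> A" "y \<in> S - A" for x y
  proof -
    have "precedes \<sigma> {1..} (p - q) (x - y)"
      using t that by (auto simp: tangent_def)
    moreover have "wedge \<sigma> (q - p) (y - x) = wedge \<sigma> (p - q) (x - y)"
      by (simp add: wedge_simps)
    moreover have "y - x = k *\<^sub>R (q - p)" if "x - y = k *\<^sub>R (p - q)" for k
      using that by (metis minus_diff_eq scaleR_minus_right)
    ultimately show ?thesis
      by (auto simp: precedes_def)
  qed
  then show ?thesis
    using t by (auto simp: tangent_def double_diff)
qed

text \<open>Two shortest first differences $p - q$ and $p' - q'$ are the same vector $d$. The mixed differences $p' - q$ and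
  $p - q'$ add up to $2 d$, and neither is allowed to precede $d$ or to be shorter than it, so both are $d$.\<close>
lemma tangent_unique:
  assumes "tangent \<sigma> S A p q" "tangent \<sigma> S A p' q'"
  shows "p = p' \<and> q = q'"
proof -
  have neq: "p - q \<noteq> 0"
    using assms by (auto simp: tangent_def)
  have pre: "precedes \<sigma> {1..} (p - q) (p' - q')" "precedes \<sigma> {1..} (p' - q') (p - q)"
    "precedes \<sigma> {1..} (p - q) (p' - q)" "precedes \<sigma> {1..} (p - q) (p - q')"
    using assms by (auto simp: tangent_def)
  have w0: "wedge \<sigma> (p - q) (p' - q') = 0"
    using pre(1,2)[THEN precedes_wedge_nonneg] wedge_swap[of \<sigma> "p - q" "p' - q'"] by linarith
  have multiple: "\<exists>k\<ge>1. w = k *\<^sub>R v" if "precedes \<sigma> {1..} v w" "wedge \<sigma> v w = 0" for v w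
    using that unfolding precedes_def by (metis atLeast_iff less_irrefl)
  have w0': "wedge \<sigma> (p' - q') (p - q) = 0"
    using w0 wedge_swap[of \<sigma> "p' - q'" "p - q"] by linarith
  obtain k l where kl: "k \<ge> 1" "p' - q' = k *\<^sub>R (p - q)" "l \<ge> 1" "p - q = l *\<^sub>R (p' - q')"
    using multiple[OF pre(1) w0] multiple[OF pre(2) w0'] by blast
  have "(l * k) *\<^sub>R (p - q) = 1 *\<^sub>R (p - q)"
    using kl(2,4) by (metis scaleR_one scaleR_scaleR)
  then have "l * k = 1"
    using neq scaleR_cancel_right by blast
  then have "k = 1"
    using kl(1,3) mult_right_mono[of 1 l k] by linarith
  have s: "(p' - q) + (p - q') = 2 *\<^sub>R (p - q)"
    using kl(2) \<open>k = 1\<close> by (simp add: algebra_simps scaleR_2)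
  have "wedge \<sigma> (p - q) (p' - q) + wedge \<sigma> (p - q) (p - q') = 0"
    using w0 wedge_swap[of \<sigma> p q] by (simp add: wedge_simps)
  then have "wedge \<sigma> (p - q) (p' - q) = 0" "wedge \<sigma> (p - q) (p - q') = 0"
    using pre(3,4)[THEN precedes_wedge_nonneg] by linarith+
  then obtain a b where ab: "a \<ge> 1" "p' - q = a *\<^sub>R (p - q)" "b \<ge> 1" "p - q' = b *\<^sub>R (p - q)"
    using multiple[OF pre(3)] multiple[OF pre(4)] by blast
  have "(a + b) *\<^sub>R (p - q) = 2 *\<^sub>R (p - q)"
    using s unfolding ab(2,4) by (simp only: scaleR_left_distrib)
  then have "a + b = 2"
    using neq scaleR_cancel_right by blast
  then have "a = 1" "b = 1"
    using ab(1,3) by linarith+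
  then show ?thesis
    using ab by simp
qed

text \<open>Take the shortest last difference.\<close>
lemma opposite_tangent_exists:
  assumes "\<sigma> \<noteq> 0" "finite S" "tangent \<sigma> S A p q"
  obtains p' q' where "tangent (- \<sigma>) S A p' q'"
proof -
  let ?D = "(\<lambda>(x, y). x - y) ` (A \<times> (S - A))"
  have t: "A \<subseteq> S" "p \<in> A" "q \<in> S - A"
    "\<And>x y. x \<in> A \<Longrightarrow> y \<in> S - A \<Longrightarrow> precedes \<sigma> {1..} (p - q) (x - y)"
    using assms(3) by (auto simp: tangent_def)
  have half: "precedes \<sigma> {0<..} (p - q) v" if "v \<in> ?D" for v
    using that t(4) by (force intro: precedes_mono)
  have fin: "finite ?D"
    using assms(2) t(1) by (auto intro: finite_subset)
  obtain v where v: "v \<in> ?D" "\<And>w. w \<in> ?D \<Longrightarrow> precedes (- \<sigma>) {1..} v w"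
  proof (rule last_direction[OF assms(1) _ fin _ half, where K = "{1..}"])
    show "p - q \<noteq> 0" "?D \<noteq> {}"
      using t by auto
    show "a * b \<in> {1..}" if "a \<in> {1..}" "b \<in> {1..}" for a b :: real
      using that mult_mono[of 1 a 1 b] by auto
    show "k \<in> {1..} \<or> inverse k \<in> {1..}" if "0 < k" for k :: real
      using that one_le_inverse[of k] by fastforce
  qed auto
  then obtain p' q' where "p' \<in> A" "q' \<in> S - A" "v = p' - q'"
    by auto
  then have "tangent (- \<sigma>) S A p' q'"
    using v(2) t(1) by (auto simp: tangent_def)
  then show thesis
    by (rule that)
qed

text \<open>If $p$ is an extreme point of $A$, the last point met by a ray rotating about $p$ spans an edge of the
  hull with it; among several such points, take the one furthest from $p$.\<close>
lemma hull_edge: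
  assumes "\<sigma> \<noteq> 0" "d \<noteq> 0" "finite A" "p \<in> A" "p' \<in> A" "p' \<noteq> p"
    and half: "\<And>x. x \<in> A \<Longrightarrow> x \<noteq> p \<Longrightarrow> precedes \<sigma> {0<..} d (x - p)"
  obtains x where "x \<in> A" "x \<noteq> p" "\<And>y. y \<in> A \<Longrightarrow> precedes \<sigma> {0..1} (p - x) (y - x)"
proof -
  let ?D = "(\<lambda>x. x - p) ` (A - {p})"
  obtain v where v: "v \<in> ?D" "\<And>w. w \<in> ?D \<Longrightarrow> precedes (- \<sigma>) {0<..1} v w"
  proof (rule last_direction[OF assms(1,2), where D = ?D and K = "{0<..1}"])
    show "finite ?D" "?D \<noteq> {}"
      using assms(3,5,6) by auto
    show "precedes \<sigma> {0<..} d v" if "v \<in> ?D" for v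
      using that half by auto
    show "a * b \<in> {0<..1}" if "a \<in> {0<..1}" "b \<in> {0<..1}" for a b :: real
      using that mult_mono[of a 1 b 1] by auto
    show "k \<in> {0<..1} \<or> inverse k \<in> {0<..1}" if "0 < k" for k :: real
      using that inverse_le_1_iff[of k] by fastforce
  qed auto
  then obtain x where x: "x \<in> A" "x \<noteq> p" "v = x - p"
    by auto
  have "precedes \<sigma> {0..1} (p - x) (y - x)" if "y \<in> A" for y
  proof (cases "y = p")
    case True
    then show ?thesis
      by (auto simp: precedes_def intro!: bexI[of _ 1])
  next
    case False
    then have "precedes (- \<sigma>) {0<..1} (x - p) (y - p)"
      using v(2) x that by auto
    moreover have "wedge \<sigma> (p - x) (y - x) = wedge (- \<sigma>) (x - p) (y - p)"
      using wedge_swap[of \<sigma> x p] by (simp add: wedge_simps)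
    moreover have "y - x = (1 - k) *\<^sub>R (p - x)" if "y - p = k *\<^sub>R (x - p)" for k
      using that by (simp add: algebra_simps)
    moreover have "1 - k \<in> {0..1}" if "k \<in> {0<..1}" for k :: real
      using that by auto
    ultimately show ?thesis
      unfolding precedes_def by metis
  qed
  then show thesis
    using x that by blast
qed

text \<open>As the separating line rotates from the tangent at $p$ to the tangent at $p'$, it must leave $p$
  before the end, and it does so across an edge of the hull of $A$. In terms of directions: the hull edge from $p$
  to $x$ comes strictly after the last difference $p' - q'$, because already $p' - p$ does, and hence after
  every $p - y$ with $y \in S - A$.\<close>
lemma facing_edge_at_tangent:
  assumes "\<sigma> \<noteq> 0" "finite S" "tangent \<sigma> S A p q" "tangent (- \<sigma>) S A p' q'" "p \<noteq> p'"
  obtains x where "facing \<sigma> S A x p"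
proof -
  let ?d = "p - q"
  have t: "A \<subseteq> S" "p \<in> A" "q \<in> S - A" "p' \<in> A" "q' \<in> S - A"
    "\<And>x y. x \<in> A \<Longrightarrow> y \<in> S - A \<Longrightarrow> precedes \<sigma> {1..} ?d (x - y)"
    "\<And>x y. x \<in> A \<Longrightarrow> y \<in> S - A \<Longrightarrow> precedes (- \<sigma>) {1..} (p' - q') (x - y)"
    using assms(3,4) by (auto simp: tangent_def)
  have d: "?d \<noteq> 0"
    using t by auto
  have diff: "precedes \<sigma> {0<..} ?d (x - y)" if "x \<in> A" "y \<in> S - A" for x y
    using t(6)[OF that] by (rule precedes_mono) auto
  have half: "precedes \<sigma> {0<..} ?d (x - p)" if "x \<in> A" "x \<noteq> p" for x
  proof -
    have "wedge \<sigma> ?d (x - q) = wedge \<sigma> ?d (x - p)"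
      using wedge_swap[of \<sigma> p q] by (simp add: wedge_simps)
    moreover have "x - p = (k - 1) *\<^sub>R ?d" if "x - q = k *\<^sub>R ?d" for k
      using that by (simp add: algebra_simps)
    moreover have "k \<noteq> 1" if "x - q = k *\<^sub>R ?d" for k
      using that \<open>x \<noteq> p\<close> by auto
    ultimately show ?thesis
      using t(6)[OF \<open>x \<in> A\<close> t(3)] unfolding precedes_def
      by (metis atLeast_iff diff_gt_0_iff_gt greaterThan_iff order_le_less)
  qed
  obtain x where x: "x \<in> A" "x \<noteq> p" "\<And>y. y \<in> A \<Longrightarrow> precedes \<sigma> {0..1} (p - x) (y - x)"
  proof (rule hull_edge[OF assms(1) d _ t(2,4)])
    show "finite A"
      using assms(2) t(1) finite_subset by blast
  qed (use assms(5) half in auto)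
  let ?v = "x - p" and ?g = "p' - q'"
  have hv: "precedes \<sigma> {0<..} ?d ?v" and hg: "precedes \<sigma> {0<..} ?d ?g"
    and hp': "precedes \<sigma> {0<..} ?d (p' - p)"
    using half x(1,2) diff t assms(5) by auto
  have "0 \<le> wedge \<sigma> (p - x) (p' - x)"
    using precedes_wedge_nonneg x(3) t(4) by blast
  then have p'v: "0 \<le> wedge \<sigma> (p' - p) ?v"
    using wedge_swap[of \<sigma> x p'] wedge_swap[of \<sigma> x p] wedge_swap[of \<sigma> p p']
    by (simp add: wedge_simps)
  have eq: "wedge (- \<sigma>) ?g (p - q') = wedge \<sigma> ?g (p' - p)"
    using wedge_swap[of \<sigma> p' q'] by (simp add: wedge_simps)
  \<comment> \<open>Otherwise $p - q'$ would be a multiple of the last difference $p' - q'$ at least as long as it, and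
    $p' - p$ would point in the opposite direction.\<close>
  have "0 < wedge \<sigma> ?g (p' - p)"
  proof (rule ccontr)
    assume "\<not> ?thesis"
    then obtain k where k: "k \<ge> 1" "p - q' = k *\<^sub>R ?g"
      using t(7)[OF t(2,5)] eq by (auto simp: precedes_def)
    then have k': "p' - p = (1 - k) *\<^sub>R ?g"
      by (simp add: algebra_simps)
    then have "wedge \<sigma> ?g (p' - p) = 0"
      by (simp only: wedge_simps)
    then obtain l where l: "l > 0" "p' - p = l *\<^sub>R ?g"
      using half_plane_parallel[OF assms(1) d hg hp'] by blast
    have "l *\<^sub>R ?g = (1 - k) *\<^sub>R ?g"
      using k' l(2) by (simp only:)
    moreover have "?g \<noteq> 0"
      using t by auto
    ultimately have "l = 1 - k"
      using scaleR_cancel_right by blast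
    then show False
      using l(1) k(1) by simp
  qed
  then have gv: "0 < wedge \<sigma> ?g ?v"
    using wedge_trans[OF hg hp' hv] p'v by auto
  have "wedge \<sigma> (p - x) (y - x) < 0" if "y \<in> S - A" for y
  proof -
    have "0 \<le> wedge (- \<sigma>) ?g (p - y)"
      using t(7)[OF t(2) that] precedes_wedge_nonneg by blast
    then have "0 \<le> wedge \<sigma> (p - y) ?g"
      using wedge_swap[of \<sigma> "p - y" ?g] by (simp add: wedge_simps(5))
    then have "0 < wedge \<sigma> (p - y) ?v"
      using wedge_trans[OF diff[OF t(2) that] hg hv] gv by auto
    then show ?thesis
      using wedge_swap[of \<sigma> x p] wedge_swap[of \<sigma> x y] wedge_swap[of \<sigma> p y]
      by (simp add: wedge_simps)
  qed
  then have "facing \<sigma> S A x p"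
    using x t by (auto simp: facing_def)
  then show thesis
    by (rule that)
qed

lemma facing_reverse: "facing (- \<sigma>) S A e f \<longleftrightarrow> facing \<sigma> S A f e"
proof -
  have w: "wedge (- \<sigma>) (f - e) (x - e) = wedge \<sigma> (e - f) (x - f)" for x
    using wedge_swap[of \<sigma> e f] by (simp add: wedge_simps)
  have param: "x - f = (1 - k) *\<^sub>R (e - f)" if "x - e = k *\<^sub>R (f - e)" for x k and e f :: "real^2"
    using that by (simp add: algebra_simps)
  have "(\<exists>k\<in>{0..1}. x - f = k *\<^sub>R (e - f))" if ex: "(\<exists>k\<in>{0..1}. x - e = k *\<^sub>R (f - e))" for x and e f :: "real^2"
  proof -
    obtain k where "k \<in> {0..1}" "x - e = k *\<^sub>R (f - e)"
      using ex by blast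
    then show ?thesis
      using param[of x e k f] by (intro bexI[of _ "1 - k"]) auto
  qed
  then have "(\<exists>k\<in>{0..1}. x - e = k *\<^sub>R (f - e)) = (\<exists>k\<in>{0..1}. x - f = k *\<^sub>R (e - f))" for x
    by blast
  then show ?thesis
    by (auto simp: facing_def precedes_def w)
qed

text \<open>If the first and the last direction agree, then all differences are parallel.\<close>
lemma opposite_tangents_differ:
  assumes "\<sigma> \<noteq> 0" "\<not> collinear S" "tangent \<sigma> S A p q"
  shows "\<not> tangent (- \<sigma>) S A p q"
proof
  assume t': "tangent (- \<sigma>) S A p q"
  let ?d = "p - q"
  have mult: "\<exists>k. x - y = k *\<^sub>R ?d" if "x \<in> A" "y \<in> S - A" for x y
  proof -
    have "precedes \<sigma> {1..} ?d (x - y)" "precedes (- \<sigma>) {1..} ?d (x - y)"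
      using assms(3) t' that by (auto simp: tangent_def)
    then show ?thesis
      by (auto simp: precedes_def wedge_simps(5))
  qed
  have pq: "p \<in> A" "q \<in> S - A"
    using assms(3) by (auto simp: tangent_def)
  have from_q: "\<exists>k. s = q + k *\<^sub>R ?d" if s: "s \<in> S" for s
  proof (cases "s \<in> A")
    case True
    then show ?thesis
      using mult[OF _ pq(2)] by (metis add.commute diff_add_cancel)
  next
    case False
    then obtain k where "p - s = k *\<^sub>R ?d"
      using mult[OF pq(1)] s by blast
    then have "s = q + (1 - k) *\<^sub>R ?d"
      by (simp add: algebra_simps)
    then show ?thesis by blast
  qed
  have "\<exists>c. x - y = c *\<^sub>R ?d" if xy: "x \<in> S" "y \<in> S" for x y
  proof -
    obtain k l where "x = q + k *\<^sub>R ?d" "y = q + l *\<^sub>R ?d"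
      using from_q xy by blast
    then have "x - y = (k - l) *\<^sub>R ?d"
      by (simp add: scaleR_left_diff_distrib)
    then show ?thesis by blast
  qed
  then have "collinear S"
    unfolding collinear_def by blast
  then show False
    using assms(2) by blast
qed

section \<open>Counting over all separations\<close>

text \<open>All pairs are ordered. For a line this accounts for the two ways to rotate it, or the two sides that it has.\<close>
definition consecutive_pairs :: "(real^2) set \<Rightarrow> ((real^2) \<times> (real^2)) set" where
  "consecutive_pairs S = {(p, q). p \<in> S \<and> q \<in> S \<and> p \<noteq> q \<and>
     (\<forall>x\<in>S. \<forall>k. x - q = k *\<^sub>R (p - q) \<longrightarrow> k \<le> 0 \<or> 1 \<le> k)}"

definition extreme_pairs :: "(real^2) set \<Rightarrow> ((real^2) \<times> (real^2)) set" where
  "extreme_pairs S = {(e, f). e \<in> S \<and> f \<in> S \<and> e \<noteq> f \<and>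
     (\<forall>x\<in>S. \<forall>k. x - e = k *\<^sub>R (f - e) \<longrightarrow> 0 \<le> k \<and> k \<le> 1)}"

text \<open>For consecutive $p$ and $q$, the set separated from its complement after the line through $p$ and $q$ has been rotated slightly about a
  point between them.\<close>
definition tangent_cell :: "real \<Rightarrow> (real^2) set \<Rightarrow> (real^2) \<times> (real^2) \<Rightarrow> (real^2) set" where
  "tangent_cell \<sigma> S = (\<lambda>(p, q). {x \<in> S. precedes \<sigma> {1..} (p - q) (x - q)})"

definition facing_cell :: "(real^2) set \<Rightarrow> (real^2) \<times> (real^2) \<Rightarrow> (real^2) set" where
  "facing_cell S = (\<lambda>(e, f). {x \<in> S. precedes 1 {0..1} (f - e) (x - e)})"

lemma finite_pairs:
  assumes "finite S"
  shows "finite (consecutive_pairs S)" "finite (extreme_pairs S)"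
  by (rule finite_subset[of _ "S \<times> S"],
      use assms in \<open>auto simp: consecutive_pairs_def extreme_pairs_def\<close>)+

text \<open>For consecutive $p$ and $q$, a point of $S$ on their line is beyond $p$ or beyond $q$, so the
  difference of two points on opposite sides is at least $p - q$.\<close>
lemma tangent_at_consecutive_pair:
  assumes "\<sigma> \<noteq> 0" "(p, q) \<in> consecutive_pairs S"
  shows "tangent \<sigma> S (tangent_cell \<sigma> S (p, q)) p q"
proof -
  let ?A = "tangent_cell \<sigma> S (p, q)" and ?d = "p - q"
  have pq: "p \<in> S" "q \<in> S" "?d \<noteq> 0"
    "\<And>x k. x \<in> S \<Longrightarrow> x - q = k *\<^sub>R ?d \<Longrightarrow> k \<le> 0 \<or> 1 \<le> k"
    using assms(2) by (auto simp: consecutive_pairs_def)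
  have A: "?A = {x \<in> S. precedes \<sigma> {1..} ?d (x - q)}"
    by (simp add: tangent_cell_def)
  have "precedes \<sigma> {1..} ?d (x - y)" if x: "x \<in> ?A" and y: "y \<in> S - ?A" for x y
  proof -
    have px: "precedes \<sigma> {1..} ?d (x - q)"
      using x by (simp add: A)
    have py: "wedge \<sigma> ?d (y - q) \<le> 0"
      using y by (auto simp: A precedes_def)
    have diff: "wedge \<sigma> ?d (x - y) = wedge \<sigma> ?d (x - q) - wedge \<sigma> ?d (y - q)"
      by (simp add: wedge_simps)
    show ?thesis
    proof (cases "wedge \<sigma> ?d (x - q) = 0 \<and> wedge \<sigma> ?d (y - q) = 0")
      case True
      then obtain k l where k: "k \<ge> 1" "x - q = k *\<^sub>R ?d" and l: "y - q = l *\<^sub>R ?d"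
        using px wedge_eq_0D[OF assms(1) pq(3)] unfolding precedes_def by (metis atLeast_iff less_irrefl)
      have "\<not> 1 \<le> l"
        using y l by (auto simp: A precedes_def)
      then have "l \<le> 0"
        using pq(4)[of y l] y l by auto
      have "x - y = (x - q) - (y - q)"
        by simp
      also have "\<dots> = (k - l) *\<^sub>R ?d"
        unfolding k(2) l by (simp only: scaleR_left_diff_distrib)
      finally show ?thesis
        using k(1) \<open>l \<le> 0\<close> by (auto simp: precedes_def)
    next
      case False
      then have "0 < wedge \<sigma> ?d (x - y)"
        using precedes_wedge_nonneg[OF px] py diff by linarith
      then show ?thesis
        by (simp add: precedes_def)
    qed
  qed
  moreover have "p \<in> ?A"
    using pq(1) by (auto simp: A precedes_def intro!: bexI[of _ 1])
  moreover have "q \<notin> ?A"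
    using pq(3) by (auto simp: A precedes_def wedge_def)
  moreover have "?A \<subseteq> S"
    by (auto simp: A)
  ultimately show ?thesis
    using pq(2) by (simp add: tangent_def)
qed

lemma facing_iff_extreme_pair:
  "facing 1 S A e f \<longleftrightarrow> (e, f) \<in> extreme_pairs S \<and> facing_cell S (e, f) = A"
proof
  assume f: "facing 1 S A e f"
  have A: "A \<subseteq> S" "e \<in> A" "f \<in> A" "e \<noteq> f"
    "\<And>x. x \<in> A \<Longrightarrow> precedes 1 {0..1} (f - e) (x - e)"
    "\<And>y. y \<in> S \<Longrightarrow> y \<notin> A \<Longrightarrow> wedge 1 (f - e) (y - e) < 0"
    using f by (auto simp: facing_def)
  have "0 \<le> k \<and> k \<le> 1" if x: "x \<in> S" "x - e = k *\<^sub>R (f - e)" for x k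
  proof -
    have w: "wedge 1 (f - e) (x - e) = 0"
      unfolding x(2) by (simp only: wedge_simps)
    then have "x \<in> A"
      using A(6) x(1) by force
    then obtain l where l: "l \<in> {0..1}" "x - e = l *\<^sub>R (f - e)"
      using A(5)[of x] w by (auto simp: precedes_def)
    then have "k = l"
      using x(2) A(4) by simp
    then show ?thesis
      using l(1) by simp
  qed
  moreover have "precedes 1 {0..1} (f - e) (x - e) \<longleftrightarrow> x \<in> A" if "x \<in> S" for x
    using A(5,6) that precedes_wedge_nonneg[of 1 "{0..1}" "f - e" "x - e"] by force
  ultimately show "(e, f) \<in> extreme_pairs S \<and> facing_cell S (e, f) = A"
    using A(1-4) by (auto simp: extreme_pairs_def facing_cell_def)
next
  assume "(e, f) \<in> extreme_pairs S \<and> facing_cell S (e, f) = A"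
  then have ef: "e \<in> S" "f \<in> S" "e \<noteq> f"
    "\<And>x k. x \<in> S \<Longrightarrow> x - e = k *\<^sub>R (f - e) \<Longrightarrow> k \<in> {0..1}"
    and A: "A = {x \<in> S. precedes 1 {0..1} (f - e) (x - e)}"
    by (auto simp: extreme_pairs_def facing_cell_def)
  have "wedge 1 (f - e) (y - e) < 0" if y: "y \<in> S - A" for y
  proof (rule ccontr)
    assume "\<not> ?thesis"
    then have w0: "wedge 1 (f - e) (y - e) = 0"
      using y by (auto simp: A precedes_def)
    obtain k where k: "y - e = k *\<^sub>R (f - e)"
      by (rule wedge_eq_0D[OF _ _ w0]) (use ef(3) in auto)
    then show False
      using ef(4)[OF _ k] y k by (auto simp: A precedes_def)
  qed
  moreover have "precedes 1 {0..1} (f - e) (e - e)" "precedes 1 {0..1} (f - e) (f - e)"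
    by (auto simp: precedes_def intro: bexI[of _ 0] bexI[of _ 1])
  ultimately show "facing 1 S A e f"
    using ef(1-3) by (auto simp: facing_def A)
qed

lemma finite_facing: "finite S \<Longrightarrow> finite {(e, f). facing \<sigma> S A e f}"
  by (rule finite_subset[of _ "S \<times> S"]) (auto simp: facing_def)

lemma finite_tangent: "finite S \<Longrightarrow> finite {(p, q). tangent \<sigma> S A p q}"
  by (rule finite_subset[of _ "S \<times> S"]) (auto simp: tangent_def)

text \<open>The properties of the weights on which the upper bound depends.\<close>
locale corner_weight =
  fixes S :: "(real^2) set" and w :: "real^2 \<Rightarrow> real^2 \<Rightarrow> real"
  assumes finite_S: "finite S" and noncollinear_S: "\<not> collinear S"
    and w_sym: "w a b = w b a" and w_nonneg: "0 \<le> w a b" and w_le_1: "w a b \<le> 1"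
    and w_triangle: "w a b + w b c + w a c \<le> 2"
begin

abbreviation edges :: "(real^2) set \<Rightarrow> ((real^2) \<times> (real^2)) set" where
  "edges A \<equiv> {(e, f). facing 1 S A e f}"

lemma edge_sum_le: "(\<Sum>(e, f)\<in>edges A. w e f) \<le> real (card (edges A))"
  using sum_bounded_above[of "edges A" "\<lambda>(e, f). w e f" 1] w_le_1 by auto

text \<open>Since $p \neq p'$, there is a facing edge of $A$ at $p$ and one at $p'$. If there is only one
  facing edge in all, it joins $p$ and $p'$, and $q = q'$ because otherwise $S - A$ would have one, too; so
  the three pairs come from the triple $p$, $p'$, $q$.\<close>
lemma two_tangents_bound:
  assumes t: "tangent 1 S A p q" "tangent (- 1) S A p' q'" and "p \<noteq> p'"
  shows "w p q + w p' q' + (\<Sum>(e, f)\<in>edges A. w e f) + (\<Sum>(e, f)\<in>edges (S - A). w e f)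
    \<le> 2 * real (card (edges A) + card (edges (S - A)))"
proof -
  have fin: "finite (edges A)" "finite (edges (S - A))"
    using finite_facing[OF finite_S] by auto
  obtain x where x: "facing 1 S A x p"
    using facing_edge_at_tangent[OF _ finite_S t assms(3)] by auto
  obtain x' where "facing (- 1) S A x' p'"
    using facing_edge_at_tangent[OF _ finite_S t(2) _ assms(3)[symmetric]] t(1) by auto
  then have x': "facing 1 S A p' x'"
    by (simp add: facing_reverse)
  show ?thesis
  proof (cases "2 \<le> card (edges A) + card (edges (S - A))")
    case True
    then have "2 \<le> real (card (edges A)) + real (card (edges (S - A)))"
      by linarith
    then show ?thesis
      using edge_sum_le[of A] edge_sum_le[of "S - A"] w_le_1[of p q] w_le_1[of p' q'] by simp
  next
    case False
    have "edges A \<noteq> {}"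
      using x by auto
    then have "card (edges A) \<noteq> 0"
      using fin by simp
    then have card: "card (edges A) = 1" "card (edges (S - A)) = 0"
      using False by linarith+
    then have empty: "edges (S - A) = {}"
      using fin by simp
    obtain z where z: "edges A = {z}"
      using card(1) card_1_singletonE by blast
    have "(x, p) \<in> edges A" "(p', x') \<in> edges A"
      using x x' by auto
    then have edge: "edges A = {(p', p)}"
      using z by auto
    have "q = q'"
    proof (rule ccontr)
      assume "q \<noteq> q'"
      then obtain y where "facing 1 S (S - A) y q"
        using facing_edge_at_tangent[OF _ finite_S t[THEN tangent_complement]] by auto
      then show False
        using empty by auto
    qed
    then show ?thesis
      unfolding edge empty using w_triangle[of p q p'] w_sym[of p p'] w_sym[of p' q]
      by simp
  qed
qed

text \<open>The case $p = p'$ and $q \neq q'$ is the previous one with $A$ and $S - A$ exchanged.\<close>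
lemma cell_bound:
  assumes "A \<subseteq> S"
  shows "(\<Sum>(p, q) | tangent 1 S A p q. w p q) + (\<Sum>(p, q) | tangent (- 1) S A p q. w p q)
      + (\<Sum>(e, f)\<in>edges A. w e f) + (\<Sum>(e, f)\<in>edges (S - A). w e f)
    \<le> 2 * real (card (edges A) + card (edges (S - A)))"
proof (cases "\<exists>p q. tangent 1 S A p q")
  case True
  then obtain p q where t: "tangent 1 S A p q" by blast
  then obtain p' q' where t': "tangent (- 1) S A p' q'"
    using opposite_tangent_exists[OF _ finite_S t] by auto
  have "tangent 1 S A a b \<longleftrightarrow> a = p \<and> b = q" "tangent (- 1) S A a b \<longleftrightarrow> a = p' \<and> b = q'" for a b
    using tangent_unique t t' by blast+
  then have T: "{(p, q). tangent 1 S A p q} = {(p, q)}" "{(p, q). tangent (- 1) S A p q} = {(p', q')}"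
    by auto
  have "p \<noteq> p' \<or> q \<noteq> q'"
    using opposite_tangents_differ[OF _ noncollinear_S t] t' by auto
  then show ?thesis
  proof
    assume "p \<noteq> p'"
    then show ?thesis
      using two_tangents_bound[OF t t'] unfolding T by simp
  next
    assume "q \<noteq> q'"
    have "S - (S - A) = A"
      using assms by auto
    then show ?thesis
      using two_tangents_bound[OF t[THEN tangent_complement] t'[THEN tangent_complement] \<open>q \<noteq> q'\<close>]
      unfolding T by (simp add: w_sym)
  qed
next
  case False
  then have "\<nexists>p q. tangent (- 1) S A p q"
    using opposite_tangent_exists[of "- 1" S A, OF _ finite_S] by (metis minus_minus neg_equal_0_iff_equal zero_neq_one)
  then have T: "{(p, q). tangent 1 S A p q} = {}" "{(p, q). tangent (- 1) S A p q} = {}"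
    using False by auto
  show ?thesis
    unfolding T using edge_sum_le[of A] edge_sum_le[of "S - A"] by simp
qed

text \<open>The separation of $S$ from the empty set has no tangents, while the facing edges are the edges of
  the hull of $S$. Since there is such an edge, the bound for this separation is strict.\<close>
lemma outer_cell_bound:
  "(\<Sum>(p, q) | tangent 1 S S p q. w p q) + (\<Sum>(p, q) | tangent (- 1) S S p q. w p q)
      + (\<Sum>(e, f)\<in>edges S. w e f) + (\<Sum>(e, f)\<in>edges (S - S). w e f)
    < 2 * real (card (edges S) + card (edges (S - S)))"
proof -
  have "S \<noteq> {}"
    using noncollinear_S by auto
  define M where "M = {x \<in> S. x $ 1 = Min ((\<lambda>x. x $ 1) ` S)}"
  have fM: "finite M" "M \<noteq> {}"
  proof -
    show "finite M" using finite_S by (simp add: M_def)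
    have "Min ((\<lambda>x. x $ 1) ` S) \<in> (\<lambda>x. x $ 1) ` S"
      using finite_S \<open>S \<noteq> {}\<close> by (intro Min_in) auto
    then show "M \<noteq> {}" by (auto simp: M_def)
  qed
  have "Max ((\<lambda>x. x $ 2) ` M) \<in> (\<lambda>x. x $ 2) ` M"
    using fM by (intro Max_in) auto
  then obtain p where p: "p \<in> M" "p $ 2 = Max ((\<lambda>x. x $ 2) ` M)"
    by auto
  have pS: "p \<in> S"
    using p(1) by (simp add: M_def)
  \<comment> \<open>The point $p$ is the upper one of the leftmost points, so the vectors from $p$ to the others point
    to the right or straight down.\<close>
  define d :: "real^2" where "d = (\<chi> i. if i = 2 then - 1 else 0)"
  have d: "d $ 1 = 0" "d $ 2 = - 1"
    by (simp_all add: d_def)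
  have half: "precedes 1 {0<..} d (x - p)" if "x \<in> S" "x \<noteq> p" for x
  proof -
    have le: "p $ 1 \<le> x $ 1"
      using p(1) that(1) finite_S by (auto simp: M_def)
    show ?thesis
    proof (cases "p $ 1 = x $ 1")
      case True
      then have "x \<in> M"
        using p(1) that(1) by (simp add: M_def)
      then have "x $ 2 \<le> p $ 2"
        using fM p(2) by simp
      then have "x $ 2 < p $ 2"
        using True that(2) by (auto simp: vec_eq_iff forall_2 less_le)
      moreover have "x - p = (p $ 2 - x $ 2) *\<^sub>R d"
        using True by (simp add: vec_eq_iff forall_2 d)
      ultimately show ?thesis
        by (auto simp: precedes_def)
    next
      case False
      then show ?thesis
        using le by (simp add: precedes_def wedge_def d)
    qed
  qed
  obtain p' where p': "p' \<in> S" "p' \<noteq> p"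
    using noncollinear_S collinear_subset[OF collinear_sing[of p], of S] by blast
  obtain x where x: "x \<in> S" "x \<noteq> p" "\<And>y. y \<in> S \<Longrightarrow> precedes 1 {0..1} (p - x) (y - x)"
  proof (rule hull_edge[OF _ _ finite_S pS p'])
    show "d \<noteq> 0" using d by auto
  qed (use half in auto)
  have "(x, p) \<in> edges S"
    using x pS by (auto simp: facing_def)
  then have pos: "0 < card (edges S)"
    using finite_facing[OF finite_S] by (auto simp: card_gt_0_iff)
  have empty: "{(p, q). tangent 1 S S p q} = {}" "{(p, q). tangent (- 1) S S p q} = {}"
    "edges (S - S) = {}"
    by (auto simp: tangent_def facing_def)
  show ?thesis
    unfolding empty using edge_sum_le[of S] pos by simp
qed

text \<open>Sum \<open>cell_bound\<close> over all subsets of $S$. Each consecutive pair is a tangent pair of one set for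
  $\sigma = 1$ and of one set for $\sigma = -1$. Each extreme pair is a facing edge of one set $A$, and is counted
  again for $S - A$. This gives the claim multiplied by 2.\<close>
lemma pair_sum_less:
  "(\<Sum>(p, q)\<in>consecutive_pairs S. w p q) + (\<Sum>(e, f)\<in>extreme_pairs S. w e f)
    < 2 * real (card (extreme_pairs S))"
proof -
  let ?w = "\<lambda>(p, q). w p q"
  let ?T = "\<lambda>\<sigma> A. \<Sum>(p, q) | tangent \<sigma> S A p q. w p q"
  note fin = finite_pairs[OF finite_S]
  have tangents: "sum ?w (consecutive_pairs S) \<le> (\<Sum>A\<in>Pow S. ?T \<sigma> A)" if "\<sigma> \<noteq> 0" for \<sigma>
  proof -
    have "sum ?w (consecutive_pairs S)
        = (\<Sum>A\<in>Pow S. sum ?w {c \<in> consecutive_pairs S. tangent_cell \<sigma> S c = A})"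
      using fin finite_S by (intro sum.group[symmetric]) (auto simp: tangent_cell_def)
    also have "\<dots> \<le> (\<Sum>A\<in>Pow S. ?T \<sigma> A)"
    proof (intro sum_mono sum_mono2)
      show "finite {(p, q). tangent \<sigma> S A p q}" for A
        using finite_tangent[OF finite_S] .
      show "{c \<in> consecutive_pairs S. tangent_cell \<sigma> S c = A} \<subseteq> {(p, q). tangent \<sigma> S A p q}" for A
        using tangent_at_consecutive_pair[OF that] by auto
    qed (auto simp: w_nonneg)
    finally show ?thesis .
  qed
  have edges: "edges A = {c \<in> extreme_pairs S. facing_cell S c = A}" for A
    by (auto simp: facing_iff_extreme_pair)
  have extremes: "(\<Sum>A\<in>Pow S. sum g (edges A)) = sum g (extreme_pairs S)" for g :: "_ \<Rightarrow> real"
    unfolding edges using fin finite_S by (intro sum.group) (auto simp: facing_cell_def)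
  have complement: "(\<Sum>A\<in>Pow S. h (S - A)) = (\<Sum>A\<in>Pow S. h A)" for h :: "_ \<Rightarrow> real"
    by (rule sum.reindex_bij_witness[of _ "\<lambda>A. S - A" "\<lambda>A. S - A"]) auto
  have "(\<Sum>A\<in>Pow S. ?T 1 A + ?T (- 1) A + sum ?w (edges A) + sum ?w (edges (S - A)))
      < (\<Sum>A\<in>Pow S. 2 * real (card (edges A) + card (edges (S - A))))"
  proof (rule sum_strict_mono_ex1)
    show "finite (Pow S)"
      using finite_S by simp
    show "\<forall>A\<in>Pow S. ?T 1 A + ?T (- 1) A + sum ?w (edges A) + sum ?w (edges (S - A))
        \<le> 2 * real (card (edges A) + card (edges (S - A)))"
      using cell_bound by blast
    show "\<exists>A\<in>Pow S. ?T 1 A + ?T (- 1) A + sum ?w (edges A) + sum ?w (edges (S - A))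
        < 2 * real (card (edges A) + card (edges (S - A)))"
      using outer_cell_bound by blast
  qed
  then have "(\<Sum>A\<in>Pow S. ?T 1 A) + (\<Sum>A\<in>Pow S. ?T (- 1) A)
      + (\<Sum>A\<in>Pow S. sum ?w (edges A)) + (\<Sum>A\<in>Pow S. sum ?w (edges (S - A)))
    < 2 * ((\<Sum>A\<in>Pow S. real (card (edges A))) + (\<Sum>A\<in>Pow S. real (card (edges (S - A)))))"
    by (simp add: sum.distrib sum_distrib_left distrib_left)
  moreover have "(\<Sum>A\<in>Pow S. sum ?w (edges (S - A))) = sum ?w (extreme_pairs S)"
    using complement[of "\<lambda>A. sum ?w (edges A)"] extremes by simp
  moreover have "(\<Sum>A\<in>Pow S. real (card (edges A))) = real (card (extreme_pairs S))"
    using extremes[of "\<lambda>_. 1"] by simp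
  moreover have "(\<Sum>A\<in>Pow S. real (card (edges (S - A)))) = real (card (extreme_pairs S))"
    using complement[of "\<lambda>A. real (card (edges A))"] extremes[of "\<lambda>_. 1"] by simp
  ultimately show ?thesis
    using tangents[of 1] tangents[of "- 1"] extremes[of ?w] by simp
qed

end

section \<open>The cyclic order of the points on a line\<close>

lemma abs_diff_le_path_sum:
  fixes v :: "nat \<Rightarrow> real"
  assumes "i \<le> j"
  shows "\<bar>v i - v j\<bar> \<le> (\<Sum>k=i..<j. \<bar>v k - v (Suc k)\<bar>)"
  using assms by (induction rule: dec_induct) auto

text \<open>Both arcs of the cycle between $i$ and $j$ have to bridge the difference.\<close>
lemma cyclic_sum_ge_twice_difference:
  fixes v :: "nat \<Rightarrow> real"
  assumes "i \<le> n" "j \<le> n"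
  shows "2 * \<bar>v i - v j\<bar> \<le> (\<Sum>k<n. \<bar>v k - v (Suc k)\<bar>) + \<bar>v 0 - v n\<bar>"
proof -
  have *: "2 * \<bar>v i - v j\<bar> \<le> (\<Sum>k<n. \<bar>v k - v (Suc k)\<bar>) + \<bar>v 0 - v n\<bar>"
    if ij: "i \<le> j" "j \<le> n" for i j
  proof -
    have path: "(\<Sum>k<n. \<bar>v k - v (Suc k)\<bar>)
        = (\<Sum>k=0..<i. \<bar>v k - v (Suc k)\<bar>) + (\<Sum>k=i..<j. \<bar>v k - v (Suc k)\<bar>)
          + (\<Sum>k=j..<n. \<bar>v k - v (Suc k)\<bar>)"
      using ij by (simp add: lessThan_atLeast0 sum.atLeastLessThan_concat)
    have detour: "\<bar>v i - v j\<bar> \<le> \<bar>v 0 - v i\<bar> + \<bar>v j - v n\<bar> + \<bar>v 0 - v n\<bar>"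
      by linarith
    have "2 * d \<le> t + c" if "t = r + s + u" "d \<le> a + b + c" "a \<le> r" "d \<le> s" "b \<le> u"
      for a b c d r s t u :: real
      using that by linarith
    from this[OF path detour] show ?thesis
      using abs_diff_le_path_sum[OF le0] abs_diff_le_path_sum[OF ij(1)]
        abs_diff_le_path_sum[OF ij(2)] by blast
  qed
  show ?thesis
    using *[of i j] *[of j i] assms by (cases "i \<le> j") (auto simp: abs_minus_commute)
qed

text \<open>In a cycle, each vertex is an end of two edges.\<close>
lemma cyclic_sum_of_endpoints:
  fixes h :: "nat \<Rightarrow> real"
  shows "(\<Sum>k<n. h k + h (Suc k)) + (h 0 + h n) = 2 * (\<Sum>k\<le>n. h k)"
  by (induction n) auto

definition line_in :: "(real^2) set \<Rightarrow> real^2 \<Rightarrow> real^2 \<Rightarrow> (real^2) set" where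
  "line_in S a b = {x \<in> S. wedge 1 (b - a) (x - a) = 0}"

text \<open>List the points of the line by the parameter $k$ in $a + k (b - a)$. Neighbours in the list are
  consecutive pairs in both orders, and only the first and the last point form extreme pairs.\<close>
lemma line_enumeration:
  assumes "finite S" "a \<in> S" "b \<in> S" "a \<noteq> b"
  obtains n x where "bij_betw x {..n} (line_in S a b)"
    "\<And>i. i < n \<Longrightarrow> (x i, x (Suc i)) \<in> consecutive_pairs S \<and> (x (Suc i), x i) \<in> consecutive_pairs S"
    "\<And>i j. i \<le> n \<Longrightarrow> j \<le> n \<Longrightarrow> i \<noteq> j \<Longrightarrow> line_in S (x i) (x j) = line_in S a b"
    "\<And>e f. (e, f) \<in> extreme_pairs S \<Longrightarrow> line_in S e f = line_in S a b \<Longrightarrow>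
       (e, f) \<in> {(x 0, x n), (x n, x 0)}"
proof -
  let ?d = "b - a" and ?L = "line_in S a b"
  define K where "K = {k. a + k *\<^sub>R ?d \<in> S}"
  define xs where "xs = sorted_list_of_set K"
  define n where "n = length xs - 1"
  define x where "x i = a + (xs ! i) *\<^sub>R ?d" for i
  have d: "?d \<noteq> 0" using assms(4) by simp
  have inj: "inj (\<lambda>k. a + k *\<^sub>R ?d)"
    using d by (auto simp: inj_on_def)
  have finK: "finite K"
    using finite_vimageI[OF assms(1) inj] by (simp add: K_def vimage_def)
  have "0 \<in> K"
    using assms(2) by (simp add: K_def)
  have set_xs: "set xs = K"
    using finK by (simp add: xs_def)
  then have len: "length xs = Suc n"
    using \<open>0 \<in> K\<close> by (cases xs) (auto simp: n_def)
  have mono: "xs ! i < xs ! j" if "i < j" "j \<le> n" for i j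
    using that len sorted_wrt_nth_less[of "(<)" xs i j] finK by (simp add: xs_def)
  have less: "xs ! i < xs ! j \<longleftrightarrow> i < j" if "i \<le> n" "j \<le> n" for i j
    using mono that by (metis linorder_neqE_nat order_less_asym order_less_irrefl)
  have K: "k \<in> K \<longleftrightarrow> (\<exists>i\<le>n. k = xs ! i)" for k
    using set_xs len by (metis in_set_conv_nth less_Suc_eq_le)
  have L: "y \<in> ?L \<longleftrightarrow> (\<exists>k\<in>K. y = a + k *\<^sub>R ?d)" for y
  proof
    assume y: "y \<in> ?L"
    then obtain k where "y - a = k *\<^sub>R ?d"
      using wedge_eq_0D[OF _ d, of 1 "y - a"] by (auto simp: line_in_def)
    then have "y = a + k *\<^sub>R ?d"
      by (simp add: algebra_simps)
    then show "\<exists>k\<in>K. y = a + k *\<^sub>R ?d"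
      using y by (auto simp: K_def line_in_def)
  next
    assume "\<exists>k\<in>K. y = a + k *\<^sub>R ?d"
    then obtain k where k: "k \<in> K" "y = a + k *\<^sub>R ?d" by blast
    have "wedge 1 ?d (k *\<^sub>R ?d) = 0" by (simp only: wedge_simps)
    then show "y \<in> ?L"
      using k by (simp add: K_def line_in_def)
  qed
  have diff: "x i - x j = (xs ! i - xs ! j) *\<^sub>R ?d" for i j
    by (simp add: x_def scaleR_left_diff_distrib)
  have eq_iff: "x i = x j \<longleftrightarrow> i = j" if "i \<le> n" "j \<le> n" for i j
    using less[OF that] less[OF that(2,1)] d unfolding x_def by auto
  have ratio: "\<exists>m\<le>n. xs ! m - xs ! i = k * (xs ! j - xs ! i)"
    if "y \<in> S" "y - x i = k *\<^sub>R (x j - x i)" for y i j k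
  proof -
    have "y - x i = (k * (xs ! j - xs ! i)) *\<^sub>R ?d"
      using that(2) by (simp add: diff)
    then have "y = x i + (k * (xs ! j - xs ! i)) *\<^sub>R ?d"
      by (metis add_diff_cancel_left' add.commute diff_add_cancel)
    then have "y = a + (xs ! i + k * (xs ! j - xs ! i)) *\<^sub>R ?d"
      by (simp add: x_def scaleR_left_distrib)
    then have "xs ! i + k * (xs ! j - xs ! i) \<in> K"
      using that(1) by (simp add: K_def)
    then show ?thesis
      unfolding K by (metis add_diff_cancel_left')
  qed
  have xL: "x i \<in> ?L" if "i \<le> n" for i
    using that L K x_def by metis
  have Lx: "\<exists>i\<le>n. y = x i" if "y \<in> ?L" for y
    using that L K x_def by metis
  have bij: "bij_betw x {..n} ?L"
    unfolding bij_betw_def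
  proof
    show "inj_on x {..n}"
      using eq_iff by (auto simp: inj_on_def)
    show "x ` {..n} = ?L"
    proof (intro equalityI subsetI)
      show "y \<in> ?L" if "y \<in> x ` {..n}" for y
        using that xL by blast
      show "y \<in> x ` {..n}" if "y \<in> ?L" for y
        using Lx[OF that] by blast
    qed
  qed
  have xS: "x i \<in> S" if "i \<le> n" for i
    using xL[OF that] by (simp add: line_in_def)
  have consecutive: "(x i, x (Suc i)) \<in> consecutive_pairs S \<and> (x (Suc i), x i) \<in> consecutive_pairs S"
    if i: "i < n" for i
  proof -
    have gap: "0 < xs ! Suc i - xs ! i"
      using less[of i "Suc i"] i by simp
    have between: "xs ! m \<le> xs ! i \<or> xs ! Suc i \<le> xs ! m" if "m \<le> n" for m
      using less[of i m] less[of m "Suc i"] that i by (metis less_Suc_eq_le not_le less_imp_le Suc_leI)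
    have forward: "k \<le> 0 \<or> 1 \<le> k" if y: "y \<in> S" "y - x i = k *\<^sub>R (x (Suc i) - x i)" for y k
    proof -
      obtain m where m: "m \<le> n" "xs ! m - xs ! i = k * (xs ! Suc i - xs ! i)"
        using ratio[OF y] by blast
      consider "k * (xs ! Suc i - xs ! i) \<le> 0" | "xs ! Suc i - xs ! i \<le> k * (xs ! Suc i - xs ! i)"
        using between[OF m(1)] m(2) by linarith
      then show ?thesis
        using gap by cases (auto simp: mult_le_0_iff)
    qed
    have backward: "k \<le> 0 \<or> 1 \<le> k" if y: "y \<in> S" "y - x (Suc i) = k *\<^sub>R (x i - x (Suc i))" for y k
    proof -
      have "y - x i = (1 - k) *\<^sub>R (x (Suc i) - x i)"
        using y(2) by (simp add: algebra_simps)
      then show ?thesis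
        using forward[OF y(1)] by fastforce
    qed
    have "x i \<noteq> x (Suc i)"
      using eq_iff[of i "Suc i"] i by simp
    then show ?thesis
      using xS[of i] xS[of "Suc i"] i forward backward by (auto simp: consecutive_pairs_def)
  qed
  have same_line: "line_in S (x i) (x j) = ?L" if ij: "i \<le> n" "j \<le> n" "i \<noteq> j" for i j
  proof -
    have nonzero: "xs ! j - xs ! i \<noteq> 0"
      using less[of i j] less[of j i] ij by auto
    have shear: "wedge 1 (c *\<^sub>R u) (v - t *\<^sub>R u) = c * wedge 1 u v" for c t and u v :: "real^2"
      by (simp add: wedge_simps)
    have flip: "y - x i = (y - a) - (xs ! i) *\<^sub>R ?d" for y
      by (simp add: x_def)
    have "wedge 1 (x j - x i) (y - x i) = (xs ! j - xs ! i) * wedge 1 ?d (y - a)" for y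
      unfolding diff[of j i] flip[of y] by (rule shear)
    then show ?thesis
      using nonzero by (simp add: line_in_def)
  qed
  have extreme: "(e, f) \<in> {(x 0, x n), (x n, x 0)}"
    if ef: "(e, f) \<in> extreme_pairs S" "line_in S e f = ?L" for e f
  proof -
    have "e \<in> line_in S e f" "f \<in> line_in S e f" "e \<noteq> f"
      using ef(1) by (auto simp: line_in_def extreme_pairs_def wedge_def)
    then obtain i j where ij: "i \<le> n" "j \<le> n" "e = x i" "f = x j" "i \<noteq> j"
      using Lx ef(2) by metis
    have bound: "0 \<le> r \<and> r \<le> 1" if "m \<le> n" "xs ! m - xs ! i = r * (xs ! j - xs ! i)" for m r
    proof -
      have "x m - e = r *\<^sub>R (f - e)"
        by (simp add: ij diff that(2))
      then show ?thesis
        using ef(1) xS[OF that(1)] by (auto simp: extreme_pairs_def)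
    qed
    let ?g = "xs ! j - xs ! i"
    have g: "?g \<noteq> 0"
      using less[OF ij(1,2)] less[OF ij(2,1)] ij(5) by auto
    have b: "0 \<le> (xs ! m - xs ! i) / ?g \<and> (xs ! m - xs ! i) / ?g \<le> 1" if "m \<le> n" for m
      using bound[OF that, of "(xs ! m - xs ! i) / ?g"] g by simp
    show ?thesis
    proof (cases "i < j")
      case True
      then have "0 < ?g" using less ij by auto
      then have "xs ! i \<le> xs ! 0" "xs ! n \<le> xs ! j"
        using b[of 0] b[of n] by (auto simp: field_simps)
      then have "i = 0" "j = n"
        using less[of 0 i] less[of j n] ij by auto
      then show ?thesis using ij by simp
    next
      case False
      then have "?g < 0" using less[of j i] ij by auto
      then have "xs ! j \<le> xs ! 0" "xs ! n \<le> xs ! i"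
        using b[of 0] b[of n] by (auto simp: field_simps)
      then have "j = 0" "i = n"
        using less[of 0 j] less[of i n] ij by auto
      then show ?thesis using ij by simp
    qed
  qed
  show thesis
    using that[OF bij consecutive same_line extreme] by blast
qed

section \<open>Weights that are large on bad lines\<close>

definition shade :: "'a set \<Rightarrow> 'a set \<Rightarrow> 'a \<Rightarrow> real" where
  "shade B R x = (if x \<in> B \<inter> R then 1/2 else if x \<in> R then 1 else 0)"

text \<open>Two points of both sets must weigh at least $2/3$ for a line with only three points, all in both sets, to be
  heavy enough, and at most $2/3$ for a triple of such points to weigh at most 2.\<close>
definition pair_weight :: "'a set \<Rightarrow> 'a set \<Rightarrow> 'a \<Rightarrow> 'a \<Rightarrow> real" where
  "pair_weight B R x y =
     (if x \<in> B \<inter> R \<and> y \<in> B \<inter> R then 2/3 else \<bar>shade B R x - shade B R y\<bar>)"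

lemma corner_weight_pair_weight:
  assumes "finite S" "\<not> collinear S"
  shows "corner_weight S (pair_weight B R)"
proof
  show "pair_weight B R a b + pair_weight B R b c + pair_weight B R a c \<le> 2" for a b c
    by (cases "a \<in> B"; cases "a \<in> R"; cases "b \<in> B"; cases "b \<in> R"; cases "c \<in> B"; cases "c \<in> R")
      (simp_all add: pair_weight_def shade_def)
qed (use assms in \<open>simp_all add: pair_weight_def shade_def abs_minus_commute\<close>)

text \<open>Ordered pairs count every cyclic sum twice, and a line has two extreme pairs, so the claim is
  that the cyclic sum is at least 2. If the line has points outside $B$ and outside $R$, it follows from the
  variation of the shade; if it has three points in both sets, distribute weight $1/3$ to each of these points from
  each of its two pairs.\<close>
lemma pair_weight_line_bound:
  assumes fin: "finite B" "finite R" and ab: "a \<in> B \<union> R" "b \<in> B \<union> R" "a \<noteq> b"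
  defines "L \<equiv> line_in (B \<union> R) a b"
  assumes bad: "\<not> (card (L \<inter> B \<inter> R) \<le> 2 \<and> (L \<subseteq> B \<or> L \<subseteq> R))"
  shows "2 * real (card {(e, f) \<in> extreme_pairs (B \<union> R). line_in (B \<union> R) e f = L})
    \<le> (\<Sum>(p, q) | (p, q) \<in> consecutive_pairs (B \<union> R) \<and> line_in (B \<union> R) p q = L. pair_weight B R p q)
      + (\<Sum>(e, f) | (e, f) \<in> extreme_pairs (B \<union> R) \<and> line_in (B \<union> R) e f = L. pair_weight B R e f)"
proof -
  let ?S = "B \<union> R" and ?w = "pair_weight B R" and ?v = "shade B R"
  let ?C = "{(p, q). (p, q) \<in> consecutive_pairs ?S \<and> line_in ?S p q = L}"
  let ?E = "{(e, f). (e, f) \<in> extreme_pairs ?S \<and> line_in ?S e f = L}"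
  have finS: "finite ?S" using fin by simp
  have sym: "?w p q = ?w q p" for p q
    by (simp add: pair_weight_def abs_minus_commute)
  have bounds: "0 \<le> ?w p q" "?w p q \<le> 1" for p q
    by (auto simp: pair_weight_def shade_def)
  obtain n x where bij: "bij_betw x {..n} L"
    and consec: "\<And>i. i < n \<Longrightarrow> (x i, x (Suc i)) \<in> consecutive_pairs ?S \<and> (x (Suc i), x i) \<in> consecutive_pairs ?S"
    and same: "\<And>i j. i \<le> n \<Longrightarrow> j \<le> n \<Longrightarrow> i \<noteq> j \<Longrightarrow> line_in ?S (x i) (x j) = L"
    and ext: "\<And>e f. (e, f) \<in> extreme_pairs ?S \<Longrightarrow> line_in ?S e f = L \<Longrightarrow> (e, f) \<in> {(x 0, x n), (x n, x 0)}"
    using line_enumeration[OF finS ab] unfolding L_def by metis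
  have inj: "inj_on x {..n}" and im: "x ` {..n} = L"
    using bij by (auto simp: bij_betw_def)
  have eq: "x i = x j \<longleftrightarrow> i = j" if "i \<le> n" "j \<le> n" for i j
    using inj that by (auto simp: inj_on_def)
  have cycle: "2 \<le> (\<Sum>i<n. ?w (x i) (x (Suc i))) + ?w (x 0) (x n)"
  proof (cases "card (L \<inter> B \<inter> R) \<le> 2")
    case True
    then obtain y z where yz: "y \<in> L" "y \<notin> B" "z \<in> L" "z \<notin> R"
      using bad by blast
    have "L \<subseteq> ?S"
      by (auto simp: L_def line_in_def)
    then have v: "?v y = 1" "?v z = 0"
      using yz by (auto simp: shade_def)
    obtain i j where ij: "i \<le> n" "j \<le> n" "y = x i" "z = x j"
      using yz(1,3) unfolding im[symmetric] by auto
    have w: "\<bar>?v p - ?v q\<bar> \<le> ?w p q" for p q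
      by (auto simp: pair_weight_def shade_def)
    have "2 \<le> (\<Sum>k<n. \<bar>?v (x k) - ?v (x (Suc k))\<bar>) + \<bar>?v (x 0) - ?v (x n)\<bar>"
      using cyclic_sum_ge_twice_difference[OF ij(1,2), of "\<lambda>k. ?v (x k)"] v ij(3,4) by simp
    also have "\<dots> \<le> (\<Sum>i<n. ?w (x i) (x (Suc i))) + ?w (x 0) (x n)"
      by (intro add_mono sum_mono w)
    finally show ?thesis .
  next
    case False
    define h :: "real^2 \<Rightarrow> real" where "h p = (if p \<in> B \<inter> R then 1/3 else 0)" for p
    have w: "h p + h q \<le> ?w p q" for p q
      by (auto simp: pair_weight_def shade_def h_def)
    have "finite L"
      using im by auto
    have "(\<Sum>i\<le>n. h (x i)) = sum h L"
      using sum.reindex_bij_betw[OF bij] .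
    also have "\<dots> = (\<Sum>p\<in>L \<inter> (B \<inter> R). 1/3)"
      unfolding h_def by (rule sum.inter_restrict[OF \<open>finite L\<close>, symmetric])
    also have "\<dots> = real (card (L \<inter> B \<inter> R)) / 3"
      by (simp add: Int_assoc)
    finally have "1 \<le> (\<Sum>i\<le>n. h (x i))"
      using False by simp
    then have "2 \<le> (\<Sum>i<n. h (x i) + h (x (Suc i))) + (h (x 0) + h (x n))"
      using cyclic_sum_of_endpoints[of "\<lambda>i. h (x i)" n] by simp
    also have "\<dots> \<le> (\<Sum>i<n. ?w (x i) (x (Suc i))) + ?w (x 0) (x n)"
      by (intro add_mono sum_mono w)
    finally show ?thesis .
  qed
  have finC: "finite ?C" "finite ?E"
    by (rule finite_subset[OF _ finite_pairs(1)[OF finS]]; auto)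
       (rule finite_subset[OF _ finite_pairs(2)[OF finS]]; auto)
  let ?up = "(\<lambda>i. (x i, x (Suc i))) ` {..<n}" and ?down = "(\<lambda>i. (x (Suc i), x i)) ` {..<n}"
  have "2 * (\<Sum>i<n. ?w (x i) (x (Suc i))) = (\<Sum>(p, q)\<in>?up. ?w p q) + (\<Sum>(p, q)\<in>?down. ?w p q)"
  proof -
    have "inj_on (\<lambda>i. (x i, x (Suc i))) {..<n}" "inj_on (\<lambda>i. (x (Suc i), x i)) {..<n}"
      by (auto simp: inj_on_def eq)
    then show ?thesis
      by (simp add: sum.reindex sym[of "x (Suc _)"])
  qed
  also have "\<dots> = (\<Sum>(p, q)\<in>?up \<union> ?down. ?w p q)"
    by (rule sum.union_disjoint[symmetric]) (auto simp: eq)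
  also have "\<dots> \<le> (\<Sum>(p, q)\<in>?C. ?w p q)"
    using consec same by (intro sum_mono2 finC) (auto simp: bounds)
  finally have C: "2 * (\<Sum>i<n. ?w (x i) (x (Suc i))) \<le> (\<Sum>(p, q)\<in>?C. ?w p q)" .
  have "n \<noteq> 0"
  proof
    assume "n = 0"
    moreover have "a \<in> L" "b \<in> L"
      using ab by (auto simp: L_def line_in_def wedge_def)
    ultimately show False
      using ab(3) unfolding im[symmetric] by auto
  qed
  then have "x 0 \<noteq> x n"
    using eq by auto
  have "(\<Sum>(e, f)\<in>?E. 2 - ?w e f) \<le> (\<Sum>(e, f)\<in>{(x 0, x n), (x n, x 0)}. 2 - ?w e f)"
  proof (rule sum_mono2)
    show "?E \<subseteq> {(x 0, x n), (x n, x 0)}"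
      using ext by blast
    show "0 \<le> (case c of (e, f) \<Rightarrow> 2 - ?w e f)" for c
      using bounds(2)[of "fst c" "snd c"] by (simp add: case_prod_beta)
  qed simp
  also have "\<dots> = 4 - 2 * ?w (x 0) (x n)"
    using \<open>x 0 \<noteq> x n\<close> by (simp add: sym[of "x n" "x 0"])
  finally have "2 * real (card ?E) \<le> (\<Sum>(e, f)\<in>?E. ?w e f) + (4 - 2 * ?w (x 0) (x n))"
    by (simp add: case_prod_beta sum_subtractf)
  then show ?thesis
    using C cycle by simp
qed

section \<open>The affine plane\<close>

text \<open>If all lines were bad, summing \<open>pair_weight_line_bound\<close> over them would contradict \<open>pair_sum_less\<close>.\<close>
lemma monochromatic_line:
  fixes B R :: "(real^2) set"
  assumes fin: "finite B" "finite R" and noncol: "\<not> collinear (B \<union> R)"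
  obtains a b where "a \<in> B \<union> R" "b \<in> B \<union> R" "a \<noteq> b"
    "card (line_in (B \<union> R) a b \<inter> B \<inter> R) \<le> 2"
    "line_in (B \<union> R) a b \<subseteq> B \<or> line_in (B \<union> R) a b \<subseteq> R"
proof (rule ccontr)
  note found = that
  assume "\<not> thesis"
  then have contra: "\<not> (card (line_in (B \<union> R) a b \<inter> B \<inter> R) \<le> 2 \<and>
      (line_in (B \<union> R) a b \<subseteq> B \<or> line_in (B \<union> R) a b \<subseteq> R))"
    if "a \<in> B \<union> R" "b \<in> B \<union> R" "a \<noteq> b" for a b
    using found that by blast
  let ?S = "B \<union> R" and ?w = "\<lambda>(p, q). pair_weight B R p q"
  define line where "line = (\<lambda>(p, q). line_in ?S p q)"
  define Lines where "Lines = line ` {(p, q). p \<in> ?S \<and> q \<in> ?S \<and> p \<noteq> q}"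
  have finS: "finite ?S" using fin by simp
  interpret corner_weight ?S "pair_weight B R"
    by (rule corner_weight_pair_weight[OF finS noncol])
  note finP = finite_pairs[OF finS]
  have finL: "finite Lines"
    unfolding Lines_def
    by (rule finite_imageI, rule finite_subset[of _ "?S \<times> ?S"]) (use finS in auto)
  have group: "(\<Sum>L\<in>Lines. sum g {c \<in> P. line c = L}) = sum g P"
    if "finite P" "P \<subseteq> {(p, q). p \<in> ?S \<and> q \<in> ?S \<and> p \<noteq> q}" for g :: "_ \<Rightarrow> real" and P
    using that finL by (intro sum.group) (auto simp: Lines_def)
  have sub: "consecutive_pairs ?S \<subseteq> {(p, q). p \<in> ?S \<and> q \<in> ?S \<and> p \<noteq> q}"
    "extreme_pairs ?S \<subseteq> {(p, q). p \<in> ?S \<and> q \<in> ?S \<and> p \<noteq> q}"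
    by (auto simp: consecutive_pairs_def extreme_pairs_def)
  have "2 * real (card {c \<in> extreme_pairs ?S. line c = L})
      \<le> sum ?w {c \<in> consecutive_pairs ?S. line c = L} + sum ?w {c \<in> extreme_pairs ?S. line c = L}"
    if L: "L \<in> Lines" for L
  proof -
    obtain a b where ab: "a \<in> ?S" "b \<in> ?S" "a \<noteq> b" "L = line_in ?S a b"
      using L by (auto simp: Lines_def line_def)
    have "\<not> (card (L \<inter> B \<inter> R) \<le> 2 \<and> (L \<subseteq> B \<or> L \<subseteq> R))"
      using contra[OF ab(1-3)] ab(4) by simp
    moreover have "{c \<in> P. line c = L} = {(p, q). (p, q) \<in> P \<and> line_in ?S p q = L}" for P
      by (auto simp: line_def)
    ultimately show ?thesis
      using pair_weight_line_bound[OF fin ab(1-3)] ab(4) by simp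
  qed
  then have "(\<Sum>L\<in>Lines. 2 * real (card {c \<in> extreme_pairs ?S. line c = L}))
      \<le> (\<Sum>L\<in>Lines. sum ?w {c \<in> consecutive_pairs ?S. line c = L}
          + sum ?w {c \<in> extreme_pairs ?S. line c = L})"
    by (rule sum_mono)
  then have "2 * real (card (extreme_pairs ?S))
      \<le> sum ?w (consecutive_pairs ?S) + sum ?w (extreme_pairs ?S)"
    using group[OF finP(1) sub(1), of ?w] group[OF finP(2) sub(2), of ?w]
      group[OF finP(2) sub(2), of "\<lambda>_. 1"]
    by (simp add: sum.distrib sum_distrib_left[symmetric])
  then show False
    using pair_sum_less by simp
qed

lemma mem_affine_hull_2_iff_wedge:
  assumes "a \<noteq> b"
  shows "x \<in> affine hull {a, b} \<longleftrightarrow> wedge 1 (b - a) (x - a) = 0"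
proof
  assume "x \<in> affine hull {a, b}"
  then obtain u where "x = a + u *\<^sub>R (b - a)"
    by (auto simp: affine_hull_2_alt)
  then have "x - a = u *\<^sub>R (b - a)"
    by (simp only: add_diff_cancel_left')
  then show "wedge 1 (b - a) (x - a) = 0"
    by (simp only: wedge_simps)
next
  assume "wedge 1 (b - a) (x - a) = 0"
  then obtain u where "x - a = u *\<^sub>R (b - a)"
    using wedge_eq_0D[of 1 "b - a" "x - a"] assms by auto
  then have "x = a + u *\<^sub>R (b - a)"
    by (simp add: algebra_simps)
  then show "x \<in> affine hull {a, b}"
    by (auto simp: affine_hull_2_alt)
qed

lemma affine_monochromatic_line:
  fixes B R :: "(real^2) set"
  assumes fin: "finite B" "finite R" and noncol: "noncollinear affine_lines (B \<union> R)"
  shows "\<exists>l\<in>affine_lines. card (l \<inter> B \<inter> R) \<le> 2 \<and> 2 \<le> card (l \<inter> (B \<union> R)) \<and>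
     (l \<inter> (B \<union> R) \<subseteq> B \<or> l \<inter> (B \<union> R) \<subseteq> R)"
proof -
  let ?S = "B \<union> R"
  obtain a b where ab: "a \<in> ?S" "b \<in> ?S" "a \<noteq> b"
    and L: "card (line_in ?S a b \<inter> B \<inter> R) \<le> 2" "line_in ?S a b \<subseteq> B \<or> line_in ?S a b \<subseteq> R"
    using monochromatic_line[OF fin] noncol unfolding noncollinear_affine_lines_iff by blast
  let ?l = "affine hull {a, b}"
  have l: "?l \<inter> ?S = line_in ?S a b"
    using mem_affine_hull_2_iff_wedge[OF ab(3)] by (auto simp: line_in_def)
  have "?l \<in> affine_lines"
    using ab(3) by (simp add: affine_lines_def aff_dim_2)
  moreover have "?l \<inter> B \<inter> R = line_in ?S a b \<inter> B \<inter> R"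
    unfolding l[symmetric] by blast
  moreover have "card {a, b} \<le> card (?l \<inter> ?S)"
    using fin ab by (intro card_mono) (auto intro: hull_inc)
  then have "2 \<le> card (?l \<inter> ?S)"
    using ab(3) by simp
  ultimately show ?thesis
    using L l by (intro bexI[of _ ?l]) auto
qed

section \<open>The projective plane\<close>

lemma collinear_wedgeD:
  fixes T :: "(real^2) set"
  assumes "collinear T"
  obtains u a where "u \<noteq> 0" "\<And>x. x \<in> T \<Longrightarrow> wedge 1 u (x - a) = 0"
proof -
  obtain u0 where u0: "\<And>x y. x \<in> T \<Longrightarrow> y \<in> T \<Longrightarrow> \<exists>c. x - y = c *\<^sub>R u0"
    using assms unfolding collinear_def by blast
  obtain u :: "real^2" where u: "u \<noteq> 0" "u0 \<noteq> 0 \<Longrightarrow> u = u0"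
    by (metis zero_neq_one)
  obtain a where a: "T \<noteq> {} \<Longrightarrow> a \<in> T"
    by blast
  have "wedge 1 u (x - a) = 0" if x: "x \<in> T" for x
  proof -
    obtain c where "x - a = c *\<^sub>R u0"
      using u0[OF x] a x by blast
    then show ?thesis
      using u(2) by (cases "u0 = 0") (auto simp: wedge_simps(3,6) wedge_def)
  qed
  then show thesis
    using that u(1) by blast
qed

text \<open>The coefficients $(1, s, s^2)$ lie on a conic. Hence a given nonzero vector is annihilated by at most
  two of these forms, and some form avoids the zeros of finitely many vectors. The kernel of the form is the line to be
  removed.\<close>
definition moment_form :: "real \<Rightarrow> real^3 \<Rightarrow> real" where
  "moment_form s v = v $ 1 + s * v $ 2 + s\<^sup>2 * v $ 3"

lemma moment_form_nonzero:
  assumes "finite V" "0 \<notin> V"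
  obtains s where "\<And>v. v \<in> V \<Longrightarrow> moment_form s v \<noteq> 0"
proof -
  have "finite {s. moment_form s v = 0}" if "v \<in> V" for v
  proof -
    have nz: "[:v $ 1, v $ 2, v $ 3:] \<noteq> 0"
    proof
      assume "[:v $ 1, v $ 2, v $ 3:] = 0"
      then have "v = 0"
        by (auto simp: vec_eq_iff forall_3 split: if_splits)
      then show False
        using that assms(2) by blast
    qed
    have "poly [:v $ 1, v $ 2, v $ 3:] s = moment_form s v" for s
      by (simp add: moment_form_def power2_eq_square algebra_simps)
    then show ?thesis
      using poly_roots_finite[OF nz] by simp
  qed
  then have "finite (\<Union>v\<in>V. {s. moment_form s v = 0})"
    using assms(1) by blast
  then obtain s where "s \<notin> (\<Union>v\<in>V. {s. moment_form s v = 0})"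
    using ex_new_if_finite[OF infinite_UNIV_char_0] by blast
  then show thesis
    using that by blast
qed

text \<open>Affine coordinates on the complement of the line given by \<open>moment_form s\<close>, whose value is the common
  denominator.\<close>
definition chart :: "real \<Rightarrow> real^3 \<Rightarrow> real^2" where
  "chart s v = vector [v $ 2 / moment_form s v, v $ 3 / moment_form s v]"

text \<open>Multiplying the equation of the affine line by \<open>moment_form s v\<close> makes it linear and homogeneous in $v$.\<close>
lemma chart_line:
  assumes "u \<noteq> 0"
  obtains W where "subspace W" "dim W = 2"
    "\<And>v. moment_form s v \<noteq> 0 \<Longrightarrow> v \<in> W \<longleftrightarrow> wedge 1 u (chart s v - a) = 0"
proof -
  define c where "c = u $ 2 * a $ 1 - u $ 1 * a $ 2"
  \<comment> \<open>The coefficients of the homogenized equation \<open>c * moment_form s v - u $ 2 * v $ 2 + u $ 1 * v $ 3 = 0\<close>\<close>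
  define n :: "real^3" where "n = vector [c, c * s - u $ 2, c * s\<^sup>2 + u $ 1]"
  have "n \<noteq> 0"
  proof
    assume "n = 0"
    then have "c = 0" "c * s - u $ 2 = 0" "c * s\<^sup>2 + u $ 1 = 0"
      by (auto simp: n_def vec_eq_iff forall_3)
    then show False
      using assms by (auto simp: vec_eq_iff forall_2)
  qed
  let ?W = "{v. n \<bullet> v = 0}"
  have "dim ?W = 2"
    using dim_hyperplane[OF \<open>n \<noteq> 0\<close>] by simp
  moreover have "v \<in> ?W \<longleftrightarrow> wedge 1 u (chart s v - a) = 0" if nz: "moment_form s v \<noteq> 0" for v
  proof -
    have "moment_form s v * wedge 1 u (chart s v - a)
        = u $ 1 * (v $ 3 - moment_form s v * a $ 2) - u $ 2 * (v $ 2 - moment_form s v * a $ 1)"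
      using nz by (simp add: wedge_def chart_def field_simps)
    also have "\<dots> = n \<bullet> v"
      by (simp add: inner_vec_def sum_3 n_def c_def moment_form_def algebra_simps)
    finally show ?thesis
      using nz by auto
  qed
  ultimately show thesis
    using that[of ?W] subspace_hyperplane[of n] by blast
qed

text \<open>Two vectors with the same image have the same normalization by \<open>moment_form s\<close>, so they span
  the same projective point.\<close>
lemma chart_eqD:
  assumes "chart s v = chart s w" "moment_form s v \<noteq> 0" "moment_form s w \<noteq> 0"
  shows "moment_form s w *\<^sub>R v = moment_form s v *\<^sub>R w"
proof -
  have 2: "moment_form s w * v $ 2 = moment_form s v * w $ 2"
    and 3: "moment_form s w * v $ 3 = moment_form s v * w $ 3"
    using assms by (auto simp: chart_def vec_eq_iff forall_2 field_simps)
  have "moment_form s w * v $ 1 = moment_form s w * (moment_form s v - s * v $ 2 - s\<^sup>2 * v $ 3)"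
    by (simp add: moment_form_def)
  also have "\<dots> = moment_form s v * moment_form s w
      - s * (moment_form s w * v $ 2) - s\<^sup>2 * (moment_form s w * v $ 3)"
    by (simp add: algebra_simps)
  also have "\<dots> = moment_form s v * (moment_form s w - s * w $ 2 - s\<^sup>2 * w $ 3)"
    unfolding 2 3 by (simp add: algebra_simps)
  also have "\<dots> = moment_form s v * w $ 1"
    by (simp add: moment_form_def)
  finally show ?thesis
    using 2 3 by (simp add: vec_eq_iff forall_3)
qed

lemma proj_point_span:
  assumes "p \<in> proj_points"
  obtains v where "v \<noteq> 0" "p = span {v}"
proof -
  have p: "subspace p" "dim p = 1"
    using assms by (auto simp: proj_points_def)
  obtain b where b: "b \<subseteq> p" "independent b" "p \<subseteq> span b" "card b = 1"
    using basis_exists[of p] p(2) by metis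
  then obtain v where v: "b = {v}"
    using card_1_singletonE by blast
  have "v \<noteq> 0"
    using b(2) v dependent_zero by blast
  moreover have "p = span {v}"
    using b(1,3) v p(1) span_minimal by blast
  ultimately show thesis
    using that by blast
qed

text \<open>The chart is injective on the finite set and matches lines with lines, so the affine result can be pulled back.\<close>
lemma projective_monochromatic_line:
  assumes proj: "B \<subseteq> proj_points" "R \<subseteq> proj_points"
    and fin: "finite B" "finite R" and noncol: "noncollinear proj_lines (B \<union> R)"
  shows "\<exists>l\<in>proj_lines. card (l \<inter> B \<inter> R) \<le> 2 \<and> 2 \<le> card (l \<inter> (B \<union> R)) \<and>
     (l \<inter> (B \<union> R) \<subseteq> B \<or> l \<inter> (B \<union> R) \<subseteq> R)"
proof -
  let ?S = "B \<union> R"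
  have "\<forall>p\<in>?S. \<exists>v. v \<noteq> 0 \<and> span {v} = p"
    using proj proj_point_span by blast
  then obtain gen where gen: "\<And>p. p \<in> ?S \<Longrightarrow> gen p \<noteq> 0" "\<And>p. p \<in> ?S \<Longrightarrow> span {gen p} = p"
    by metis
  have "finite (gen ` ?S)" "0 \<notin> gen ` ?S"
    using fin gen(1) by auto
  then obtain s where "\<And>v. v \<in> gen ` ?S \<Longrightarrow> moment_form s v \<noteq> 0"
    using moment_form_nonzero[of "gen ` ?S"] by metis
  then have s: "moment_form s (gen p) \<noteq> 0" if "p \<in> ?S" for p
    using that by blast
  define \<phi> where "\<phi> p = chart s (gen p)" for p
  have inj: "inj_on \<phi> ?S"
  proof (rule inj_onI)
    fix p q assume pq: "p \<in> ?S" "q \<in> ?S" "\<phi> p = \<phi> q"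
    have eq: "moment_form s (gen q) *\<^sub>R gen p = moment_form s (gen p) *\<^sub>R gen q"
      using chart_eqD pq s by (simp add: \<phi>_def)
    have "p = span {gen p}"
      using gen(2)[OF pq(1)] by simp
    also have "\<dots> = span {moment_form s (gen q) *\<^sub>R gen p}"
      using span_image_scale[of "{gen p}" "\<lambda>_. moment_form s (gen q)"] s[OF pq(2)] by simp
    also have "\<dots> = span {gen q}"
      unfolding eq using span_image_scale[of "{gen q}" "\<lambda>_. moment_form s (gen p)"] s[OF pq(1)] by simp
    also have "\<dots> = q"
      using gen(2)[OF pq(2)] .
    finally show "p = q" .
  qed
  have proj_line: "\<exists>l\<in>proj_lines. \<forall>p\<in>?S. p \<in> l \<longleftrightarrow> wedge 1 u (\<phi> p - a) = 0" if u: "u \<noteq> 0" for u a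
  proof -
    obtain W where W: "subspace W" "dim W = 2"
      "\<And>v. moment_form s v \<noteq> 0 \<Longrightarrow> v \<in> W \<longleftrightarrow> wedge 1 u (chart s v - a) = 0"
      using chart_line[OF u] by blast
    have "p \<in> {p \<in> proj_points. p \<subseteq> W} \<longleftrightarrow> wedge 1 u (\<phi> p - a) = 0" if p: "p \<in> ?S" for p
    proof -
      have "p \<subseteq> W \<longleftrightarrow> gen p \<in> W"
        using gen(2)[OF p] W(1) span_minimal[of "{gen p}" W] span_base[of "gen p" "{gen p}"] by auto
      then show ?thesis
        using W(3)[OF s[OF p]] p proj by (auto simp: \<phi>_def)
    qed
    then show ?thesis
      using W(1,2) by (intro bexI[of _ "{p \<in> proj_points. p \<subseteq> W}"]) (auto simp: proj_lines_def)
  qed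
  have "\<not> collinear (\<phi> ` B \<union> \<phi> ` R)"
  proof
    assume "collinear (\<phi> ` B \<union> \<phi> ` R)"
    then obtain u a where u: "u \<noteq> 0" "\<And>x. x \<in> \<phi> ` B \<union> \<phi> ` R \<Longrightarrow> wedge 1 u (x - a) = 0"
      using collinear_wedgeD by blast
    obtain l where "l \<in> proj_lines" "\<forall>p\<in>?S. p \<in> l \<longleftrightarrow> wedge 1 u (\<phi> p - a) = 0"
      using proj_line[OF u(1)] by blast
    then show False
      using u(2) noncol by (auto simp: noncollinear_def)
  qed
  then obtain a b where ab: "a \<in> \<phi> ` B \<union> \<phi> ` R" "b \<in> \<phi> ` B \<union> \<phi> ` R" "a \<noteq> b"
    and card: "card (line_in (\<phi> ` B \<union> \<phi> ` R) a b \<inter> \<phi> ` B \<inter> \<phi> ` R) \<le> 2"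
    and mono: "line_in (\<phi> ` B \<union> \<phi> ` R) a b \<subseteq> \<phi> ` B \<or> line_in (\<phi> ` B \<union> \<phi> ` R) a b \<subseteq> \<phi> ` R"
    using monochromatic_line[of "\<phi> ` B" "\<phi> ` R"] fin by blast
  let ?L = "line_in (\<phi> ` B \<union> \<phi> ` R) a b"
  obtain l where l: "l \<in> proj_lines" "\<And>p. p \<in> ?S \<Longrightarrow> p \<in> l \<longleftrightarrow> wedge 1 (b - a) (\<phi> p - a) = 0"
    using proj_line[of "b - a" a] ab(3) by auto
  have mem: "p \<in> l \<longleftrightarrow> \<phi> p \<in> ?L" if "p \<in> ?S" for p
    using l(2)[OF that] that by (auto simp: line_in_def)
  have preimage: "p \<in> C" if "p \<in> ?S" "C \<subseteq> ?S" "\<phi> p \<in> \<phi> ` C" for p C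
    using that inj inj_on_image_mem_iff by metis
  have "card (l \<inter> B \<inter> R) \<le> card (?L \<inter> \<phi> ` B \<inter> \<phi> ` R)"
  proof (rule card_inj_on_le)
    show "inj_on \<phi> (l \<inter> B \<inter> R)"
      using inj by (rule inj_on_subset) auto
    show "\<phi> ` (l \<inter> B \<inter> R) \<subseteq> ?L \<inter> \<phi> ` B \<inter> \<phi> ` R"
      using mem by auto
  qed (use fin in auto)
  moreover have "2 \<le> card (l \<inter> ?S)"
  proof -
    have "a \<in> ?L" "b \<in> ?L"
      using ab by (auto simp: line_in_def wedge_def)
    moreover obtain p q where "p \<in> ?S" "q \<in> ?S" "a = \<phi> p" "b = \<phi> q"
      using ab(1,2) by blast
    ultimately have "{p, q} \<subseteq> l \<inter> ?S" "p \<noteq> q"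
      using mem ab(3) by auto
    then show ?thesis
      using card_mono[of "l \<inter> ?S" "{p, q}"] fin by simp
  qed
  moreover have "l \<inter> ?S \<subseteq> B \<or> l \<inter> ?S \<subseteq> R"
    using mono mem preimage by blast
  ultimately show ?thesis
    using l(1) card by (intro bexI[of _ l]) auto
qed

theorem corollary1:
  "(\<forall>(B :: (real^2) set) R.
      finite B \<and> finite R \<and> noncollinear affine_lines (B \<union> R) \<longrightarrow>
      (\<exists>l\<in>affine_lines.
         card (l \<inter> B \<inter> R) \<le> 2 \<and> 2 \<le> card (l \<inter> (B \<union> R)) \<and>
         (l \<inter> (B \<union> R) \<subseteq> B \<or> l \<inter> (B \<union> R) \<subseteq> R)))
   \<and>
   (\<forall>B R. B \<subseteq> proj_points \<and> R \<subseteq> proj_points \<and>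
      finite B \<and> finite R \<and> noncollinear proj_lines (B \<union> R) \<longrightarrow>
      (\<exists>l\<in>proj_lines.
         card (l \<inter> B \<inter> R) \<le> 2 \<and> 2 \<le> card (l \<inter> (B \<union> R)) \<and>
         (l \<inter> (B \<union> R) \<subseteq> B \<or> l \<inter> (B \<union> R) \<subseteq> R)))"
  by (intro conjI allI impI; elim conjE; rule affine_monochromatic_line projective_monochromatic_line; assumption)

end
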